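(* There is an absolute constant $C'$ such that the following holds. Let $C_{\mathrm{PFR}}$ be an admissible PFR exponent (as defined in the context), with implied constant $c$. Then there is a constant $C$, depending only on $C_{\mathrm{PFR}}$ and $c$, such that: for every $D$ and every $K$, if $A \subseteq \mathbf{Z}^D$ is a finite non-empty set with $\sigma[A] \leq K$, then there is $A' \subseteq A$ with $$\frac{|A'|}{|A|} \geq \exp\left(-C (\log K)^{2 - \frac{1}{C_{\mathrm{PFR}}}}\right) \quad\text{and}\quad \dim A' \leq C' \log K.$$
   Context: For a finite non-empty subset $A$ of an abelian group, $\sigma[A] = |A+A|/|A|$ is its doubling constant. For $A\subseteq\mathbf{Z}^D$, $\dim A$ is the (affine) dimension of $A$, i.e. the dimension of the real span of $A-A$. $\log$ is the natural logarithm. Admissible PFR exponent: a real constant $C_{\mathrm{PFR}}$ for which there is a constant $c>0$ (the implied constant) such that for every $D$, every $K$ and every non-empty $A\subseteq\mathbf{F}_2^D$ with $\sigma[A]\leq K$, the set $A$ is covered by at most $\exp(c(\log (2K))^{C_{\mathrm{PFR}}})$ cosets of some subspace $H\leq\mathbf{F}_2^D$ of size at most $|A|$. *)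

theory Defs
  imports Complex_Main "HOL-Library.Function_Algebras" "HOL-Library.Set_Algebras" "HOL-Library.Z2"
begin

text \<open>
  Since the dimension \<open>D\<close> is quantified inside the statement (the constants must not depend
  on it), \<open>R\<^sup>D\<close> is the set of functions on \<^typ>\<open>nat\<close> vanishing outside \<open>{..<D}\<close>,
  with pointwise operations; \<^typ>\<open>bit\<close> is the field with two elements.
\<close>

definition coord_space :: "nat \<Rightarrow> (nat \<Rightarrow> 'a::zero) set" where
  "coord_space D = {v. \<forall>i\<ge>D. v i = 0}"

definition fun_scale :: "'a::field \<Rightarrow> (nat \<Rightarrow> 'a) \<Rightarrow> nat \<Rightarrow> 'a" where
  "fun_scale c v = (\<lambda>i. c * v i)"

global_interpretation fun_vs: vector_space "fun_scale :: 'a::field \<Rightarrow> (nat \<Rightarrow> 'a) \<Rightarrow> nat \<Rightarrow> 'a"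
  by unfold_locales (auto simp: fun_scale_def fun_eq_iff algebra_simps)

definition doubling :: "'a::plus set \<Rightarrow> real" where
  "doubling A = real (card (A + A)) / real (card A)"

text \<open>The library's \<open>dim\<close> of a set is the dimension of its linear span.\<close>

definition affine_dim :: "(nat \<Rightarrow> int) set \<Rightarrow> nat" where
  "affine_dim A = fun_vs.dim {(\<lambda>i. real_of_int ((a - b) i)) | a b. a \<in> A \<and> b \<in> A}"

definition admissible_PFR :: "real \<Rightarrow> real \<Rightarrow> bool" where
  "admissible_PFR C\<^sub>P c \<longleftrightarrow> c > 0 \<and>
     (\<forall>(D::nat) (K::real) (A :: (nat \<Rightarrow> bit) set).
        A \<subseteq> coord_space D \<and> A \<noteq> {} \<and> doubling A \<le> K \<longrightarrow>
        (\<exists>H. fun_vs.subspace H \<and> H \<subseteq> coord_space D \<and> card H \<le> card A \<and>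
          (\<exists>\<C>. \<C> \<subseteq> {v +o H | v. v \<in> coord_space D} \<and> finite \<C> \<and>
               real (card \<C>) \<le> exp (c * ln (2 * K) powr C\<^sub>P) \<and> A \<subseteq> \<Union>\<C>)))"

end

theory Submission
  imports Defs "HOL-Computational_Algebra.Group_Closure"
begin

text \<open>
  For finite sets \<open>A\<close>, \<open>B\<close> in a lattice \<open>\<Lambda>\<close> consider
  \<open>T = |A + B| / (|A||B|)\<^sup>1\<^sup>/\<^sup>2\<close> and a homomorphism \<open>\<psi>\<close> from \<open>\<Lambda>\<close> to a vector space over the
  field with two elements. Bounding \<open>|A + B|\<close> from below by the sum over \<open>z\<close> of the largest
  \<open>|A\<^sub>x + B\<^sub>y|\<close> with \<open>x + y = z\<close>, where \<open>A\<^sub>x\<close>, \<open>B\<^sub>y\<close> are the fibres of \<open>\<psi>\<close>, one sees that some pair of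
  fibres has \<open>T\<^sup>R\<close> smaller by at least the factor \<open>p x q y\<close> lost in density, unless the fibre
  densities \<open>p\<close>, \<open>q\<close> satisfy \<open>\<Sum>\<^sub>z max (p x q y)\<^sup>s < 1\<close> with \<open>s = 1/2 + 1/R\<close>. Start from reduction modulo
  \<open>2\<Lambda>\<close>, for which \<open>A\<close> has a fibre of density at least \<open>T\<^sup>-\<^sup>2\<close> because
  \<open>|X + 2\<cdot>B| \<le> |X + B + B|\<close> is small for some \<open>X \<subseteq> A\<close>, and divide by the subgroup \<open>H\<close> that maximises
  the product of the largest fibre densities divided by \<open>|H|\<^sup>1\<^sup>/\<^sup>8\<^sup>1\<close>. Then the exceptional case cannot
  occur once \<open>R\<close> is a large multiple of \<open>1 + (ln K)\<^sup>1\<^sup>-\<^sup>1\<^sup>/\<^sup>C\<close>: subgroups of order two show that \<open>p\<close> and \<open>q\<close>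
  have one dominant value each, so that \<open>R\<close> is bounded by the min-entropy, and then level sets of \<open>p\<close>
  and \<open>q\<close> have small doubling and the subgroup provided by the hypothesis contradicts the choice
  of \<open>H\<close>. Iterating loses a factor at most \<open>T\<^sup>R\<close> in density; the iteration only stops when \<open>\<psi>\<close> is
  constant on both sets, and when \<open>\<Lambda>\<close> is generated by their differences this forces
  \<open>2 ^ rank \<Lambda> \<le> |H|\<close>.
\<close>

section \<open>Growth of sumsets: Petridis' inequality, and Ruzsa's triangle inequality in exponent
  two\<close>

section \<open>Sumsets\<close>

lemma card_translate [simp]: "card (a +o A) = card A" for a :: "'a::cancel_ab_semigroup_add"
proof -
  have "a +o A = (+) a ` A" by (auto simp: elt_set_plus_def)
  then show ?thesis by (simp add: card_image)
qed

lemma card_le_sumset: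
  fixes A B :: "'a::cancel_ab_semigroup_add set"
  assumes "finite A" "finite B" "a \<in> A"
  shows "card B \<le> card (A + B)"
proof -
  have "card (a +o B) \<le> card (A + B)"
    using assms by (intro card_mono finite_set_plus set_plus_mono3)
  then show ?thesis by simp
qed

lemma card_le_sumset':
  fixes A B :: "'a::cancel_ab_semigroup_add set"
  assumes "finite A" "finite B" "b \<in> B"
  shows "card A \<le> card (A + B)"
  using card_le_sumset[OF assms(2,1,3)] by (simp add: add.commute)

text \<open>Induction on \<open>C\<close>. When \<open>c\<close> is added, the translates
  \<open>x + c + B\<close> with \<open>x\<close> in \<open>Z\<close> already lie in
  \<open>X + B + C\<close>, so at most \<open>|X + B| - |Z + B|\<close> elements are new, and
  minimality of the ratio bounds \<open>|Z + B|\<close> from below by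
  \<open>|X + B| |Z| / |X|\<close>. On the other side \<open>X + C\<close> gains
  \<open>|X| - |W|\<close> elements, and \<open>W\<close> is contained in \<open>Z\<close>.\<close>

lemma petridis:
  fixes X B C :: "'a::cancel_ab_semigroup_add set"
  assumes fin: "finite X" "finite B" "finite C"
    and min: "\<And>Z. Z \<subseteq> X \<Longrightarrow> card (X + B) * card Z \<le> card (Z + B) * card X"
  shows "card X * card (X + B + C) \<le> card (X + B) * card (X + C)"
  using fin(3)
proof (induction C)
  case empty
  then show ?case by simp
next
  case (insert c C)
  define Z where "Z = {x \<in> X. (x + c) +o B \<subseteq> X + B + C}"
  define W where "W = {x \<in> X. x + c \<in> X + C}"
  have Z: "Z \<subseteq> X" and W: "W \<subseteq> X" by (auto simp: Z_def W_def)
  have finZ: "finite Z" "finite W" using Z W fin(1) finite_subset by auto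
  have "W \<subseteq> Z"
  proof
    fix x assume x: "x \<in> W"
    have "(x + c) +o B \<subseteq> (X + C) + B" using x by (intro set_plus_mono3) (auto simp: W_def)
    then show "x \<in> Z" using x by (auto simp: Z_def W_def ac_simps)
  qed
  then have WZ: "card W \<le> card Z" using finZ by (simp add: card_mono)
  have sub: "X + B + insert c C \<subseteq> (X + B + C) \<union> (c +o ((X + B) - (Z + B)))"
  proof
    fix y assume "y \<in> X + B + insert c C"
    then obtain w d where w: "w \<in> X + B" "d \<in> insert c C" "y = w + d"
      by (auto elim!: set_plus_elim)
    show "y \<in> (X + B + C) \<union> (c +o ((X + B) - (Z + B)))"
    proof (cases "d \<in> C")
      case True
      then show ?thesis using w by auto
    next
      case False
      then have d: "d = c" using w by auto
      show ?thesis
      proof (cases "w \<in> Z + B")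
        case True
        then obtain z b where zb: "z \<in> Z" "b \<in> B" "w = z + b" by (auto elim: set_plus_elim)
        have "(z + c) + b \<in> (z + c) +o B" using zb by (intro set_plus_intro2) auto
        then have "(z + c) + b \<in> X + B + C" using zb by (auto simp: Z_def)
        then show ?thesis using w d zb by (simp add: ac_simps)
      next
        case False
        then have "c + w \<in> c +o ((X + B) - (Z + B))" using w by (intro set_plus_intro2) auto
        then show ?thesis using w d by (simp add: ac_simps)
      qed
    qed
  qed
  have finXB: "finite (X + B)" "finite (X + B + C)" "finite (X + C)"
    using fin insert by (auto intro!: finite_set_plus)
  have ZB: "Z + B \<subseteq> X + B" using Z by (intro set_plus_mono2) auto
  have finD: "finite (c +o ((X + B) - (Z + B)))"
    unfolding elt_set_plus_def using finXB by (auto simp: setcompr_eq_image)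
  have up: "card (X + B + insert c C) + card (Z + B) \<le> card (X + B + C) + card (X + B)"
  proof -
    have "card (X + B + insert c C) \<le> card (X + B + C) + card (c +o ((X + B) - (Z + B)))"
      using card_mono[OF _ sub] card_Un_le finXB finD by (meson finite_UnI le_trans)
    moreover have "card (c +o ((X + B) - (Z + B))) + card (Z + B) = card (X + B)"
      using card_Diff_subset[OF finite_subset[OF ZB finXB(1)] ZB] card_mono[OF finXB(1) ZB] by simp
    ultimately show ?thesis by linarith
  qed
  have low: "card (X + C) + card X \<le> card (X + insert c C) + card W"
  proof -
    have eq: "X + insert c C = (X + C) \<union> (c +o (X - W))"
      unfolding W_def by (auto simp: set_plus_def elt_set_plus_def ac_simps)
    have disj: "(X + C) \<inter> (c +o (X - W)) = {}"
      unfolding W_def by (auto simp: elt_set_plus_def ac_simps)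
    have "finite (c +o (X - W))" 
      unfolding elt_set_plus_def using fin by (auto simp: setcompr_eq_image)
    then have "card (X + insert c C) = card (X + C) + card (c +o (X - W))"
      unfolding eq using disj finXB by (intro card_Un_disjoint) auto
    moreover have "card (c +o (X - W)) + card W = card X"
      using W fin finZ by (auto simp: card_Diff_subset card_mono)
    ultimately show ?thesis by linarith
  qed
  have 1: "card X * card (X + B + insert c C) + card X * card (Z + B)
     \<le> card X * card (X + B + C) + card X * card (X + B)"
    using mult_le_mono2[OF up, of "card X"] by (simp add: algebra_simps)
  have 2: "card (X + B) * card (X + C) + card (X + B) * card X
     \<le> card (X + B) * card (X + insert c C) + card (X + B) * card W"
    using mult_le_mono2[OF low, of "card (X + B)"] by (simp add: algebra_simps)
  have 3: "card (X + B) * card W \<le> card (X + B) * card Z" using WZ by simp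
  have 4: "card (X + B) * card Z \<le> card X * card (Z + B)" using min[OF Z] by (simp add: mult.commute)
  show ?case using 1 2 3 4 insert.IH mult.commute[of "card X" "card (X + B)"] by linarith
qed

text \<open>Petridis' inequality with \<open>C = B\<close>, for a non-empty \<open>X\<close>
  minimising \<open>|X + B| / |X|\<close>; the minimum is at most the ratio for \<open>A\<close>
  itself.\<close>

lemma petridis_iterated_sumset:
  fixes A B :: "'a::cancel_ab_semigroup_add set"
  assumes fin: "finite A" "finite B" and ne: "A \<noteq> {}" "B \<noteq> {}"
  obtains X where "X \<subseteq> A" "X \<noteq> {}"
    "real (card (X + B + B)) \<le> (real (card (A + B)) / real (card A))\<^sup>2 * real (card X)"
proof -
  define r where "r = (\<lambda>X. real (card (X + B)) / real (card X))"
  define S where "S = Pow A - {{}}"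
  have S: "finite S" "S \<noteq> {}" using fin ne by (auto simp: S_def)
  obtain X where X: "X \<in> S" and least: "\<And>Z. Z \<in> S \<Longrightarrow> r X \<le> r Z"
    using arg_min_if_finite[OF S, of r] by (metis arg_min_least[OF S] )
  have XA: "X \<subseteq> A" "X \<noteq> {}" "finite X" using X fin finite_subset by (auto simp: S_def)
  have cX: "card X > 0" using XA by (simp add: card_gt_0_iff)
  have "card X * card (X + B + B) \<le> card (X + B) * card (X + B)"
  proof (rule petridis[OF XA(3) fin(2) fin(2)])
    fix Z assume Z: "Z \<subseteq> X"
    show "card (X + B) * card Z \<le> card (Z + B) * card X"
    proof (cases "Z = {}")
      case False
      then have "Z \<in> S" using Z XA by (auto simp: S_def)
      from least[OF this] have l: "r X \<le> r Z" .
      have "card Z > 0" using False Z XA finite_subset by (auto simp: card_gt_0_iff)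
      with l cX have "real (card (X + B)) * real (card Z) \<le> real (card (Z + B)) * real (card X)"
        by (simp add: r_def field_simps)
      then show ?thesis by (metis of_nat_le_iff of_nat_mult)
    qed simp
  qed
  then have "real (card X) * real (card (X + B + B)) \<le> real (card (X + B)) * real (card (X + B))"
    by (metis of_nat_le_iff of_nat_mult)
  then have "real (card (X + B + B)) \<le> (r X)\<^sup>2 * real (card X)"
    using cX by (simp add: r_def power2_eq_square field_simps)
  also have "\<dots> \<le> (r A)\<^sup>2 * real (card X)"
    using least[of A] ne by (intro mult_right_mono power_mono) (auto simp: S_def r_def)
  finally show thesis using that XA by (auto simp: r_def)
qed

text \<open>Fix one representation \<open>d = a d + c d\<close> of each \<open>d\<close> in
  \<open>P + P\<close>. The pair \<open>(a d + b, c d + b)\<close> determines \<open>d\<close>, the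
  sum of its entries because \<open>b + b = 0\<close>, and then \<open>b\<close>.\<close>

lemma ruzsa_triangle_exponent2:
  fixes P Q :: "'a::ab_group_add set"
  assumes fin: "finite P" "finite Q" and two: "\<And>x::'a. x + x = 0"
  shows "card (P + P) * card Q \<le> card (P + Q) * card (P + Q)"
proof -
  have "\<forall>d. \<exists>a c. d \<in> P + P \<longrightarrow> a \<in> P \<and> c \<in> P \<and> d = a + c"
    by (meson set_plus_elim)
  then obtain a c where ac: "\<And>d. d \<in> P + P \<Longrightarrow> a d \<in> P \<and> c d \<in> P \<and> d = a d + c d"
    by metis
  let ?f = "\<lambda>(d, b). (a d + b, c d + b)"
  have sum: "(a d + b) + (c d + b) = d" if "d \<in> P + P" for d b
    using ac[OF that] two[of b] by (metis add.assoc add.commute add.right_neutral)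
  have "inj_on ?f ((P + P) \<times> Q)"
    by (rule inj_onI, clarsimp) (metis sum add_left_cancel)
  moreover have "?f ` ((P + P) \<times> Q) \<subseteq> (P + Q) \<times> (P + Q)"
    using ac by auto
  ultimately have "card ((P + P) \<times> Q) \<le> card ((P + Q) \<times> (P + Q))"
    using fin by (meson card_inj_on_le finite_SigmaI finite_set_plus)
  then show ?thesis by (simp add: card_cartesian_product)
qed

section \<open>Linear algebra in finite spaces over the field with two elements\<close>

section \<open>Vectors over the field with two elements\<close>

lemma bit_add_self [simp]: "x + x = 0" for x :: bit
  by (cases x) auto

lemma bit_fun_add_self [simp]: "x + x = 0" for x :: "'b \<Rightarrow> bit"
  by (simp add: fun_eq_iff)

lemma bit_fun_add_eq_0_iff: "x + y = 0 \<longleftrightarrow> x = y" for x y :: "'b \<Rightarrow> bit"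
  by (metis add_right_cancel bit_fun_add_self)

lemma bit_fun_add_left_cancel [simp]: "x + (x + y) = y" for x y :: "'b \<Rightarrow> bit"
  by (simp add: add.assoc[symmetric])

lemma bit_fun_minus [simp]: "- x = x" "x - y = x + y" for x y :: "'b \<Rightarrow> bit"
proof -
  show "- x = x" by (metis minus_unique bit_fun_add_self)
  then show "x - y = x + y" by (metis diff_conv_add_uminus minus_unique bit_fun_add_self)
qed

lemma subspace_bit_iff:
  "fun_vs.subspace (H :: (nat \<Rightarrow> bit) set) \<longleftrightarrow> 0 \<in> H \<and> (\<forall>x\<in>H. \<forall>y\<in>H. x + y \<in> H)"
proof -
  have sc: "fun_scale c x = (if c = 0 then 0 else x)" for c :: bit and x
    by (cases c) (auto simp: fun_scale_def fun_eq_iff)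
  show ?thesis by (auto simp: fun_vs.subspace_def sc)
qed

lemma coord_space_0 [simp]: "0 \<in> coord_space n"
  by (simp add: coord_space_def)

lemma coord_space_add: "x \<in> coord_space n \<Longrightarrow> y \<in> coord_space n \<Longrightarrow> x + y \<in> coord_space n"
  for x y :: "nat \<Rightarrow> 'a::monoid_add"
  by (simp add: coord_space_def)

lemma bij_betw_coord_space_bit:
  "bij_betw (\<lambda>S i. if i \<in> S then 1 else (0::bit)) (Pow {..<n}) (coord_space n)"
  by (rule bij_betw_byWitness[where f' = "\<lambda>v. {i. v i = 1}"])
     (auto simp: coord_space_def fun_eq_iff not_le[symmetric] split: if_splits)

lemma finite_coord_space_bit [simp]: "finite (coord_space n :: (nat \<Rightarrow> bit) set)"
  using bij_betw_finite[OF bij_betw_coord_space_bit, of n] by simp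

lemma card_coord_space_bit: "card (coord_space n :: (nat \<Rightarrow> bit) set) = 2 ^ n"
  using bij_betw_same_card[OF bij_betw_coord_space_bit, of n] by (simp add: card_Pow)

text \<open>A nonzero subspace contains a vector with some coordinate \<open>i\<close> equal to \<open>1\<close>; the shear
  \<open>x \<mapsto> x + x\<^sub>i v\<close> kills exactly that vector, and one proceeds with the image.\<close>
lemma exists_additive_with_kernel:
  assumes "fun_vs.subspace V" "V \<subseteq> coord_space n"
  shows "\<exists>\<pi> :: (nat \<Rightarrow> bit) \<Rightarrow> nat \<Rightarrow> bit. (\<forall>x y. \<pi> (x + y) = \<pi> x + \<pi> y)
    \<and> \<pi> ` coord_space n \<subseteq> coord_space n \<and> (\<forall>x. \<pi> x = 0 \<longleftrightarrow> x \<in> V)"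
  using assms
proof (induction "card V" arbitrary: V rule: less_induct)
  case less
  have finV: "finite V" using less.prems finite_coord_space_bit finite_subset by metis
  show ?case
  proof (cases "V = {0}")
    case True
    then show ?thesis by (intro exI[of _ id]) auto
  next
    case False
    then obtain v where v: "v \<in> V" "v \<noteq> 0"
      using less.prems by (auto simp: subspace_bit_iff)
    then obtain i where i: "v i = 1" by (auto simp: fun_eq_iff)
    define \<sigma> :: "(nat \<Rightarrow> bit) \<Rightarrow> nat \<Rightarrow> bit" where "\<sigma> = (\<lambda>x. if x i = 1 then x + v else x)"
    have add: "\<sigma> (x + y) = \<sigma> x + \<sigma> y" for x y
      by (cases "x i"; cases "y i") (auto simp: \<sigma>_def ac_simps)
    have \<sigma>0: "\<sigma> x = 0 \<longleftrightarrow> x = 0 \<or> x = v" for x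
      using i by (auto simp: \<sigma>_def bit_fun_add_eq_0_iff)
    have im: "\<sigma> ` V \<subseteq> V" using less.prems v by (auto simp: \<sigma>_def subspace_bit_iff)
    have mem: "\<sigma> x \<in> \<sigma> ` V \<longleftrightarrow> x \<in> V" for x
    proof
      assume "\<sigma> x \<in> \<sigma> ` V"
      then obtain y where y: "y \<in> V" "\<sigma> x = \<sigma> y" by auto
      then have "\<sigma> (x + y) = 0" by (simp add: add)
      then have "x = y \<or> x = v + y" by (auto simp: \<sigma>0 bit_fun_add_eq_0_iff ac_simps)
      then show "x \<in> V" using y v less.prems by (auto simp: subspace_bit_iff)
    qed auto
    have sub: "fun_vs.subspace (\<sigma> ` V)"
    proof -
      have "0 \<in> \<sigma> ` V" using less.prems \<sigma>0 by (force simp: subspace_bit_iff)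
      moreover have "x + y \<in> \<sigma> ` V" if "x \<in> \<sigma> ` V" "y \<in> \<sigma> ` V" for x y
        using that less.prems by (auto simp: add[symmetric] subspace_bit_iff)
      ultimately show ?thesis by (simp add: subspace_bit_iff)
    qed
    \<comment> \<open>Every vector in the image of \<open>\<sigma>\<close> has \<open>i\<close>-th
      coordinate \<open>0\<close>, so \<open>v\<close> is lost and the cardinality drops, as the
      induction requires.\<close>
    have "v \<notin> \<sigma> ` V"
    proof
      assume "v \<in> \<sigma> ` V"
      then obtain x where x: "v = \<sigma> x" by auto
      then have "\<sigma> x i = 1" using i by simp
      then show False using i by (auto simp: \<sigma>_def split: if_splits)
    qed
    then have "\<sigma> ` V \<subset> V" using im v by auto
    then have "card (\<sigma> ` V) < card V" using finV by (simp add: psubset_card_mono)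
    then have "\<exists>\<pi> :: (nat \<Rightarrow> bit) \<Rightarrow> nat \<Rightarrow> bit. (\<forall>x y. \<pi> (x + y) = \<pi> x + \<pi> y)
      \<and> \<pi> ` coord_space n \<subseteq> coord_space n \<and> (\<forall>x. \<pi> x = 0 \<longleftrightarrow> x \<in> \<sigma> ` V)"
      by (rule less.hyps[OF _ sub order.trans[OF im less.prems(2)]])
    then obtain \<pi> :: "(nat \<Rightarrow> bit) \<Rightarrow> nat \<Rightarrow> bit" where
      \<pi>: "\<forall>x y. \<pi> (x + y) = \<pi> x + \<pi> y" "\<pi> ` coord_space n \<subseteq> coord_space n"
        "\<forall>x. \<pi> x = 0 \<longleftrightarrow> x \<in> \<sigma> ` V" by (elim exE conjE)
    have "\<sigma> x \<in> coord_space n" if "x \<in> coord_space n" for x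
      using that v less.prems(2) by (auto simp: \<sigma>_def coord_space_add)
    then have im': "(\<pi> \<circ> \<sigma>) ` coord_space n \<subseteq> coord_space n"
      using \<pi>(2) by (simp add: image_subset_iff)
    show ?thesis
    proof (intro exI[of _ "\<pi> \<circ> \<sigma>"] conjI allI)
      show "(\<pi> \<circ> \<sigma>) (x + y) = (\<pi> \<circ> \<sigma>) x + (\<pi> \<circ> \<sigma>) y" for x y
        using \<pi>(1) by (simp add: add)
      show "(\<pi> \<circ> \<sigma>) x = 0 \<longleftrightarrow> x \<in> V" for x using \<pi>(3) mem by simp
    qed (rule im')
  qed
qed

section \<open>The size of an admissible exponent, and the hypothesis applied to pairs of
  sets\<close>

section \<open>Consequences of an admissible exponent\<close>

lemma admissible_PFRD:
  fixes A :: "(nat \<Rightarrow> bit) set"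
  assumes "admissible_PFR C\<^sub>P c" "A \<subseteq> coord_space D" "A \<noteq> {}" "doubling A \<le> K"
  obtains H \<C> where "fun_vs.subspace H" "H \<subseteq> coord_space D" "card H \<le> card A"
    "\<C> \<subseteq> {v +o H | v. v \<in> coord_space D}" "finite \<C>"
    "real (card \<C>) \<le> exp (c * ln (2 * K) powr C\<^sub>P)" "A \<subseteq> \<Union>\<C>"
proof -
  have "\<exists>H. fun_vs.subspace H \<and> H \<subseteq> coord_space D \<and> card H \<le> card A \<and>
      (\<exists>\<C>. \<C> \<subseteq> {v +o H | v. v \<in> coord_space D} \<and> finite \<C> \<and>
        real (card \<C>) \<le> exp (c * ln (2 * K) powr C\<^sub>P) \<and> A \<subseteq> \<Union>\<C>)"
    using assms(2-4) assms(1)[unfolded admissible_PFR_def, THEN conjunct2, rule_format, of A D K]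
    by (simp only: simp_thms)
  then show thesis by (elim exE conjE) (rule that)
qed

lemma cover_popular:
  assumes "finite \<C>" "finite A" "A \<noteq> {}" "A \<subseteq> \<Union>\<C>" "real (card \<C>) \<le> N"
  obtains X where "X \<in> \<C>" "real (card A) \<le> N * real (card (A \<inter> X))"
proof -
  have ne: "\<C> \<noteq> {}" using assms by auto
  have "real (card A) \<le> (\<Sum>X\<in>\<C>. real (card (A \<inter> X)))"
  proof -
    have "card A = card (\<Union>X\<in>\<C>. A \<inter> X)"
      using assms(4) by (intro arg_cong[where f = card]) auto
    also have "\<dots> \<le> (\<Sum>X\<in>\<C>. card (A \<inter> X))" by (rule card_UN_le[OF assms(1)])
    finally show ?thesis by (metis of_nat_le_iff of_nat_sum)
  qed
  moreover obtain X where X: "X \<in> \<C>" "\<And>Y. Y \<in> \<C> \<Longrightarrow> card (A \<inter> Y) \<le> card (A \<inter> X)"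
  proof -
    have "Max ((\<lambda>Y. card (A \<inter> Y)) ` \<C>) \<in> (\<lambda>Y. card (A \<inter> Y)) ` \<C>"
      using assms(1) ne by (intro Max_in) auto
    then obtain X where "X \<in> \<C>" "Max ((\<lambda>Y. card (A \<inter> Y)) ` \<C>) = card (A \<inter> X)" by auto
    then show thesis using that assms(1) by (metis Max_ge finite_imageI imageI)
  qed
  moreover have "(\<Sum>Y\<in>\<C>. real (card (A \<inter> Y))) \<le> real (card \<C>) * real (card (A \<inter> X))"
    using X sum_bounded_above[of \<C> "\<lambda>Y. real (card (A \<inter> Y))" "real (card (A \<inter> X))"] by simp
  moreover have "real (card \<C>) * real (card (A \<inter> X)) \<le> N * real (card (A \<inter> X))"
    using assms(5) by (simp add: mult_right_mono)
  ultimately have "real (card A) \<le> N * real (card (A \<inter> X))" by linarith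
  with X show thesis using that by blast
qed

text \<open>Test the hypothesis on the standard basis: a coset of \<open>H\<close> containing \<open>m\<close> basis vectors
  forces \<open>H\<close> to contain the \<open>m choose 2\<close> distinct pairwise sums.\<close>
lemma admissible_basis_bound:
  assumes adm: "admissible_PFR C\<^sub>P c" and n: "n \<ge> 2"
  shows "sqrt (real n) \<le> 3 * exp (c * ln (2 * real n) powr C\<^sub>P)"
proof -
  define \<chi> :: "nat set \<Rightarrow> nat \<Rightarrow> bit" where "\<chi> = (\<lambda>S i. if i \<in> S then 1 else 0)"
  have inj: "inj \<chi>" by (rule injI) (auto simp: \<chi>_def fun_eq_iff split: if_splits)
  define A where "A = (\<lambda>i. \<chi> {i}) ` {..<n}"
  have inj1: "inj (\<lambda>i. \<chi> {i})" using inj by (auto simp: inj_def)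
  have cA: "card A = n" using inj1 by (simp add: A_def card_image inj_on_subset)
  have finA: "finite A" by (simp add: A_def)
  have AD: "A \<subseteq> coord_space n" by (auto simp: A_def \<chi>_def coord_space_def)
  have "card (A + A) \<le> card (A \<times> A)"
    unfolding set_plus_image using finA by (intro card_image_le) auto
  then have "real (card (A + A)) \<le> real n * real n"
    by (metis cA card_cartesian_product of_nat_le_iff of_nat_mult)
  then have "doubling A \<le> real n" using n by (simp add: doubling_def cA field_simps)
  moreover have "A \<noteq> {}" using n by (auto simp: A_def lessThan_empty_iff)
  ultimately obtain H \<C> where H: "fun_vs.subspace H" "H \<subseteq> coord_space n" "card H \<le> card A"
    and C: "\<C> \<subseteq> {v +o H | v. v \<in> coord_space n}" "finite \<C>"
    "real (card \<C>) \<le> exp (c * ln (2 * real n) powr C\<^sub>P)" "A \<subseteq> \<Union>\<C>"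
    using admissible_PFRD[OF adm AD] by blast
  define N where "N = exp (c * ln (2 * real n) powr C\<^sub>P)"
  obtain X where X: "X \<in> \<C>" "real (card A) \<le> N * real (card (A \<inter> X))"
    using cover_popular[OF C(2) finA \<open>A \<noteq> {}\<close> C(4) C(3)[folded N_def]] .
  then obtain v where v: "X = v +o H" using C by auto
  define S where "S = {i. i < n \<and> \<chi> {i} \<in> X}"
  have finS: "finite S" by (auto simp: S_def)
  have "A \<inter> X = (\<lambda>i. \<chi> {i}) ` S" by (auto simp: A_def S_def)
  then have cS: "card (A \<inter> X) = card S" using inj1 by (simp add: card_image inj_on_subset)
  have "\<chi> ` {T. T \<subseteq> S \<and> card T = 2} \<subseteq> H"
  proof clarify
    fix T assume T: "T \<subseteq> S" "card T = 2"
    then obtain i j where ij: "T = {i, j}" "i \<noteq> j" by (auto simp: card_2_iff)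
    obtain h1 h2 where h: "h1 \<in> H" "\<chi> {i} = v + h1" "h2 \<in> H" "\<chi> {j} = v + h2"
      using T ij by (auto simp: S_def v elt_set_plus_def)
    have "\<chi> T = \<chi> {i} + \<chi> {j}" using ij by (auto simp: \<chi>_def fun_eq_iff)
    also have "\<dots> = h1 + h2" by (simp add: h ac_simps)
    finally show "\<chi> T \<in> H" using h H by (auto simp: subspace_bit_iff)
  qed
  moreover have "finite H" using H finite_coord_space_bit finite_subset by metis
  ultimately have "card (\<chi> ` {T. T \<subseteq> S \<and> card T = 2}) \<le> n"
    using H cA card_mono by (metis le_trans)
  then have "card S choose 2 \<le> n"
    using inj finS by (simp add: card_image inj_on_subset n_subsets)
  then have "real (card S choose 2) \<le> real n" by simp
  moreover have "real (card S choose 2) = real (card S) * (real (card S) - 1) / 2"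
    by (simp add: choose_two real_of_nat_div) (cases "card S", auto simp: real_of_nat_div algebra_simps)
  ultimately have "real (card S) * (real (card S) - 1) \<le> 2 * real n" by simp
  have m: "real (card S) \<le> 3 * sqrt (real n)"
  proof (rule ccontr)
    define r where "r = sqrt (real n)"
    have r: "r * r = real n" "r \<ge> 1" using n by (auto simp: r_def)
    assume "\<not> real (card S) \<le> 3 * sqrt (real n)"
    then have "3 * r < real (card S)" by (simp add: r_def)
    then have "(3 * r) * (3 * r - 1) \<le> real (card S) * (real (card S) - 1)"
      using r by (intro mult_mono) auto
    also have "\<dots> \<le> 2 * (r * r)" using \<open>real (card S) * _ \<le> _\<close> r by simp
    finally have "7 * (r * r) \<le> 3 * r" by (simp add: algebra_simps)
    moreover have "r * 1 \<le> r * r" using r by (intro mult_left_mono) auto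
    ultimately show False using r by linarith
  qed
  have "N \<ge> 0" by (simp add: N_def)
  have "sqrt (real n) * sqrt (real n) \<le> N * (3 * sqrt (real n))"
    using X(2) mult_left_mono[OF m \<open>N \<ge> 0\<close>] cA cS by simp
  then have "sqrt (real n) * sqrt (real n) \<le> (3 * N) * sqrt (real n)" by (simp add: ac_simps)
  moreover have "sqrt (real n) > 0" using n by simp
  ultimately have "sqrt (real n) \<le> 3 * N" using mult_le_cancel_right_pos by blast
  then show ?thesis by (simp add: N_def)
qed

text \<open>For a smaller exponent, \<open>ln (2 * n) powr C\<^sub>P\<close> would be of lower order
  than \<open>ln n\<close>, against the lower bound from the standard basis. The result makes
  \<open>1 - 1 / C\<^sub>P\<close> nonnegative, hence the corresponding power monotone.\<close>

lemma admissible_exponent_ge_1: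
  assumes adm: "admissible_PFR C\<^sub>P c"
  shows "C\<^sub>P \<ge> 1"
proof (rule ccontr)
  assume "\<not> C\<^sub>P \<ge> 1"
  then have C: "C\<^sub>P - 1 < 0" by simp
  have c: "c > 0" using adm by (simp add: admissible_PFR_def)
  have lim: "filterlim (\<lambda>n. ln (2 * real n)) at_top sequentially"
    by (intro filterlim_compose[OF ln_at_top] filterlim_tendsto_pos_mult_at_top[OF tendsto_const]
        filterlim_real_sequentially) auto
  have "((\<lambda>n. ln (2 * real n) powr (C\<^sub>P - 1)) \<longlongrightarrow> 0) sequentially"
    by (rule tendsto_neg_powr[OF C lim])
  \<comment> \<open>With \<open>x = ln (2 * n)\<close>, this threshold makes the exponent
    \<open>c * x powr C\<^sub>P\<close> at most \<open>x / 4\<close>, whereas \<open>sqrt n\<close>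
    is \<open>exp ((x - ln 2) / 2)\<close>; then \<open>x > 12\<close> outweighs the factor
    \<open>3\<close> and the \<open>ln 2\<close>.\<close>
  then have ev1: "eventually (\<lambda>n. ln (2 * real n) powr (C\<^sub>P - 1) < 1 / (4 * c)) sequentially"
    using c by (intro order_tendstoD) auto
  have ev2: "eventually (\<lambda>n. ln (2 * real n) > 12) sequentially"
    using lim by (simp add: filterlim_at_top_dense)
  have "eventually (\<lambda>n. ln (2 * real n) powr (C\<^sub>P - 1) < 1 / (4 * c) \<and> ln (2 * real n) > 12 \<and> n \<ge> 2)
    sequentially" by (intro eventually_conj ev1 ev2 eventually_ge_at_top)
  then obtain n where n: "ln (2 * real n) powr (C\<^sub>P - 1) < 1 / (4 * c)" "ln (2 * real n) > 12" "n \<ge> 2"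
    using eventually_happens'[OF sequentially_bot] by blast
  define x where "x = ln (2 * real n)"
  have x: "x > 12" using n by (simp add: x_def)
  have "x powr C\<^sub>P = x * x powr (C\<^sub>P - 1)" using x by (simp add: powr_diff)
  also have "\<dots> \<le> x * (1 / (4 * c))" using n x by (intro mult_left_mono) (auto simp: x_def)
  finally have "c * x powr C\<^sub>P \<le> x / 4" using c by (simp add: field_simps)
  moreover have "sqrt (real n) = exp ((x - ln 2) / 2)"
  proof -
    have "exp (x - ln 2) = real n" using n by (simp add: x_def exp_diff)
    moreover have "(exp ((x - ln 2) / 2))\<^sup>2 = exp (x - ln 2)" by (simp flip: exp_double)
    ultimately show ?thesis by (intro real_sqrt_unique) auto
  qed
  moreover have "(3::real) \<le> exp 2" using exp_ge_add_one_self[of 2] by simp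
  moreover have "3 * exp (c * x powr C\<^sub>P) \<le> exp 2 * exp (x / 4)"
    using calculation by (intro mult_mono) auto
  ultimately have "exp ((x - ln 2) / 2) \<le> exp 2 * exp (x / 4)"
    using admissible_basis_bound[OF adm n(3)] by (simp add: x_def)
  then have "(x - ln 2) / 2 \<le> 2 + x / 4" by (simp flip: exp_add)
  then show False using x ln_2_less_1 by (simp add: field_simps)
qed

text \<open>The triangle inequality bounds the doubling of \<open>P\<close> by
  \<open>M\<^sup>2\<close>, and the hypothesis gives \<open>V\<close> with a coset holding a
  proportion \<open>1 / N\<close> of \<open>P\<close>. The same \<open>V\<close> serves
  \<open>Q\<close>: every coset met by \<open>Q\<close> costs a copy of that piece of
  \<open>P\<close> inside \<open>P + Q\<close>, so few cosets are met and one of them is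
  popular.\<close>

lemma admissible_pair:
  fixes P Q :: "(nat \<Rightarrow> bit) set"
  assumes adm: "admissible_PFR C\<^sub>P c"
    and sub: "P \<subseteq> coord_space n" "Q \<subseteq> coord_space n" and ne: "P \<noteq> {}" "Q \<noteq> {}"
    and M: "real (card (P + Q)) \<le> M * sqrt (real (card P) * real (card Q))"
    and N: "N = exp (c * ln (2 * M\<^sup>2) powr C\<^sub>P)"
  obtains V x y where "fun_vs.subspace V" "V \<subseteq> coord_space n" "card V \<le> card P"
    "x \<in> coord_space n" "y \<in> coord_space n"
    "real (card P) \<le> N * real (card (P \<inter> (x +o V)))"
    "real (card Q) \<le> N * M\<^sup>2 * real (card (Q \<inter> (y +o V)))"
proof -
  have fin: "finite P" "finite Q" using sub by (auto intro: finite_subset[OF _ finite_coord_space_bit])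
  have pos: "card P > 0" "card Q > 0" using fin ne by (auto simp: card_gt_0_iff)
  have "card (P + Q) > 0"
    using card_le_sumset[OF fin] ne pos by (metis all_not_in_conv less_le_trans)
  then have "0 < M * sqrt (real (card P) * real (card Q))" using M
    by (metis less_le_trans of_nat_0_less_iff)
  then have M0: "M > 0" by (rule zero_less_mult_pos2) (use pos in simp)
  have sq: "real (card (P + Q)) * real (card (P + Q)) \<le> M\<^sup>2 * (real (card P) * real (card Q))"
    using power_mono[OF M, of 2] by (simp add: power_mult_distrib flip: power2_eq_square)
  have "real (card (P + P)) * real (card Q) \<le> real (card (P + Q)) * real (card (P + Q))"
    using ruzsa_triangle_exponent2[OF fin] by (metis bit_fun_add_self of_nat_le_iff of_nat_mult)
  with sq have "real (card (P + P)) * real (card Q) \<le> (M\<^sup>2 * real (card P)) * real (card Q)"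
    by (simp add: ac_simps)
  then have "real (card (P + P)) \<le> M\<^sup>2 * real (card P)" using pos by simp
  then have "doubling P \<le> M\<^sup>2" using pos by (simp add: doubling_def field_simps)
  from admissible_PFRD[OF adm sub(1) ne(1) this] obtain V \<C> where
    V: "fun_vs.subspace V" "V \<subseteq> coord_space n" "card V \<le> card P" and
    C: "\<C> \<subseteq> {v +o V | v. v \<in> coord_space n}" "finite \<C>" "real (card \<C>) \<le> N" "P \<subseteq> \<Union>\<C>"
    unfolding N .
  obtain X where X: "X \<in> \<C>" "real (card P) \<le> N * real (card (P \<inter> X))"
    using cover_popular[OF C(2) fin(1) ne(1) C(4,3)] .
  then obtain x where x: "X = x +o V" "x \<in> coord_space n" using C by auto
  define P' where "P' = P \<inter> X"
  have N0: "N > 0" by (simp add: N)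
  have cP': "real (card P') > 0" using X pos N0 by (auto simp: P'_def intro: ccontr)
  define \<D> where "\<D> = (\<lambda>q. q +o V) ` Q"
  have finD: "finite \<D>" using fin by (simp add: \<D>_def)
  have QD: "Q \<subseteq> \<Union>\<D>"
    using V by (auto simp: \<D>_def elt_set_plus_def subspace_bit_iff)
  text \<open>Each coset of \<open>V\<close> met by \<open>Q\<close> contributes a translate of \<open>P'\<close> to \<open>P + Q\<close>, and these
    translates lie in different cosets of \<open>V\<close>.\<close>
  have "card \<D> * card P' \<le> card (P + Q)"
  proof -
    have "\<forall>Y\<in>\<D>. \<exists>q. q \<in> Q \<and> Y = q +o V" by (auto simp: \<D>_def)
    then obtain r where r: "\<And>Y. Y \<in> \<D> \<Longrightarrow> r Y \<in> Q \<and> Y = r Y +o V" by metis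
    have "inj_on (\<lambda>(Y, p). p + r Y) (\<D> \<times> P')"
    proof (rule inj_onI, clarsimp)
      fix Y p Z p'
      assume a: "Y \<in> \<D>" "p \<in> P'" "Z \<in> \<D>" "p' \<in> P'" and eq: "p + r Y = p' + r Z"
      obtain u u' where u: "u \<in> V" "p = x + u" "u' \<in> V" "p' = x + u'"
        using a by (auto simp: P'_def x elt_set_plus_def)
      have rYZ: "r Y = (u + u') + r Z"
      proof -
        have "u + r Y = u' + r Z" using eq by (simp add: u add.assoc)
        then have "u + (u + r Y) = u + (u' + r Z)" by simp
        then show ?thesis by (simp add: add.assoc)
      qed
      have uu: "u + u' \<in> V" using u V by (auto simp: subspace_bit_iff)
      have "r Y +o V = r Z +o V"
      proof -
        have "(u + u') +o V = V"
        proof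
          show s: "(u + u') +o V \<subseteq> V" using uu V by (auto simp: elt_set_plus_def subspace_bit_iff)
          show "V \<subseteq> (u + u') +o V"
          proof
            fix w assume "w \<in> V"
            then have "(u + u') + w \<in> V" using uu V by (auto simp: subspace_bit_iff)
            then have "(u + u') + ((u + u') + w) \<in> (u + u') +o V" by (rule set_plus_intro2)
            then show "w \<in> (u + u') +o V" by simp
          qed
        qed
        then show ?thesis by (metis rYZ add.commute set_plus_rearrange2)
      qed
      then have "Y = Z" using r a by metis
      then show "Y = Z \<and> p = p'" using eq by simp
    qed
    moreover have "(\<lambda>(Y, p). p + r Y) ` (\<D> \<times> P') \<subseteq> P + Q" using r by (auto simp: P'_def)
    moreover have "finite (P + Q)" using fin by (rule finite_set_plus)
    ultimately have "card (\<D> \<times> P') \<le> card (P + Q)" by (metis card_inj_on_le)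
    then show ?thesis by (simp add: card_cartesian_product)
  qed
  then have D: "real (card \<D>) * real (card P') \<le> real (card (P + Q))"
    by (metis of_nat_le_iff of_nat_mult)
  \<comment> \<open>\<open>|Q|\<close> is at most \<open>|P + Q|\<close>, whose square is at most
    \<open>M\<^sup>2 |P| |Q|\<close>. This compares \<open>|Q|\<close> with \<open>|P|\<close>, and
    then \<open>|P + Q|\<close> with \<open>|P|\<close> alone.\<close>
  have QM: "real (card Q) \<le> M\<^sup>2 * real (card P)"
  proof -
    have "real (card Q) \<le> real (card (P + Q))" using card_le_sumset[OF fin] ne by auto
    then have "real (card Q) * real (card Q) \<le> M\<^sup>2 * (real (card P) * real (card Q))"
      using sq by (smt (verit) mult_mono of_nat_0_le_iff)
    then have "real (card Q) * real (card Q) \<le> (M\<^sup>2 * real (card P)) * real (card Q)"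
      by (simp add: ac_simps)
    then show ?thesis using pos by simp
  qed
  have "real (card (P + Q)) \<le> M\<^sup>2 * real (card P)"
  proof -
    have "real (card (P + Q)) * real (card (P + Q)) \<le> M\<^sup>2 * (real (card P) * (M\<^sup>2 * real (card P)))"
      using sq QM by (smt (verit) mult_left_mono of_nat_0_le_iff zero_le_power2)
    also have "\<dots> = (M\<^sup>2 * real (card P))\<^sup>2" by (simp add: power2_eq_square)
    finally show ?thesis by (metis M0 mult_nonneg_nonneg of_nat_0_le_iff power2_eq_square power2_le_imp_le zero_le_power2)
  qed
  then have "real (card \<D>) * real (card P') \<le> M\<^sup>2 * (N * real (card P'))"
    using D X(2) by (smt (verit) P'_def mult_left_mono zero_le_power2)
  then have "real (card \<D>) * real (card P') \<le> (N * M\<^sup>2) * real (card P')" by (simp add: ac_simps)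
  then have "real (card \<D>) \<le> N * M\<^sup>2" using cP' by simp
  then obtain Y where Y: "Y \<in> \<D>" "real (card Q) \<le> N * M\<^sup>2 * real (card (Q \<inter> Y))"
    using cover_popular[OF finD fin(2) ne(2) QD] by metis
  then obtain y where "Y = y +o V" "y \<in> coord_space n" using sub by (auto simp: \<D>_def)
  then show thesis using that V x X Y by metis
qed

section \<open>Elementary inequalities for logarithms, powers and dyadic level sets\<close>

section \<open>Weights with few popular sums\<close>

lemma ln_2_ge_half: "1 / 2 \<le> ln (2::real)"
  using ln_le_minus_one[of "1 / 2 :: real"] by (simp add: ln_div)

text \<open>Here \<open>h\<close> stands for a min-entropy, \<open>J\<close> for a number of dyadic
  scales and \<open>ln (4 * J) + 2 * J * ln 2 / R\<close> for the logarithm of a sumset ratio. The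
  critical term \<open>2 * J * ln 2 / R\<close> is at most \<open>(8 / C0) * h powr (1 / C)\<close>;
  its \<open>C\<close>-th power is a small multiple of \<open>h\<close> when \<open>C0\<close> is
  large, and the logarithms are of lower order.\<close>

lemma parameter_choice:
  fixes C c :: real
  assumes C: "C \<ge> 1" and c: "c > 0"
  obtains C0 :: real where "C0 \<ge> 4"
    "\<And>R h J. \<lbrakk>R \<ge> C0; R \<ge> C0 * h powr (1 - 1 / C); h > R / 4; J \<ge> 1; J * ln 2 \<le> 3 * h + 4\<rbrakk> \<Longrightarrow>
       2 * ln (4 * J) + 2 * (c * (ln 2 + 2 * (ln (4 * J) + 2 * J * ln 2 / R)) powr C)
         + 2 * (ln (4 * J) + 2 * J * ln 2 / R) + J * ln 2 / 81 < h"
proof -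
  define a where "a = 1 / C"
  have a: "0 < a" "a \<le> 1" using C by (auto simp: a_def)
  \<comment> \<open>Once \<open>ln 2 + 2 * l \<le> \<delta> * h powr a\<close> is known, the two
    bounds on \<open>\<delta>\<close> make the term with \<open>c\<close> and the term
    \<open>2 * l\<close> each at most \<open>h / 16\<close>.\<close>
  define \<delta> where "\<delta> = min (1 / 16) ((1 / (16 * c)) powr a)"
  have \<delta>: "0 < \<delta>" "\<delta> \<le> 1 / 16" using c by (auto simp: \<delta>_def)
  have \<delta>C: "c * \<delta> powr C \<le> 1 / 16"
  proof -
    have "\<delta> powr C \<le> ((1 / (16 * c)) powr a) powr C"
      using \<delta> C by (intro powr_mono2) (auto simp: \<delta>_def)
    also have "\<dots> = 1 / (16 * c)" using C c by (simp add: powr_powr a_def)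
    finally show ?thesis using c by (simp add: field_simps)
  qed
  \<comment> \<open>The number \<open>28\<close> arises from \<open>J \<le> 7 * h\<close>. Replacing
    \<open>ln h\<close> by a multiple of \<open>h powr (a / 2)\<close> keeps the logarithmic part
    below the order \<open>h powr a\<close>.\<close>
  define E :: real where "E = ln 2 + 2 * ln 28"
  have "((\<lambda>h. E * h powr (- a) + (4 / a) * h powr (- (a / 2))) \<longlongrightarrow> E * 0 + (4 / a) * 0) at_top"
    using a by (intro tendsto_intros tendsto_neg_powr filterlim_ident) auto
  then have "eventually (\<lambda>h. E * h powr (- a) + (4 / a) * h powr (- (a / 2)) < \<delta> / 2) at_top"
    using \<delta> by (intro order_tendstoD) auto
  then obtain H0 where H0: "\<And>h. h \<ge> H0 \<Longrightarrow> E * h powr (- a) + (4 / a) * h powr (- (a / 2)) < \<delta> / 2"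
    by (auto simp: eventually_at_top_linorder)
  \<comment> \<open>As \<open>h > R / 4\<close>, the first two entries yield
    \<open>h \<ge> H0\<close> and \<open>h \<ge> 12\<close>; the third makes \<open>8 / C0\<close>
    at most \<open>\<delta> / 4\<close>.\<close>
  define C0 where "C0 = Max {4 * H0, 48, 32 / \<delta>}"
  have C0: "C0 \<ge> 4 * H0" "C0 \<ge> 48" "C0 \<ge> 32 / \<delta>" by (auto simp: C0_def)
  show thesis
  proof (rule that[of C0])
    show "4 \<le> C0" using C0 by simp
    fix R h J :: real
    assume R: "R \<ge> C0" "R \<ge> C0 * h powr (1 - 1 / C)" and hR: "h > R / 4" and J: "J \<ge> 1"
      and Jh: "J * ln 2 \<le> 3 * h + 4"
    have h: "h \<ge> H0" "h \<ge> 12" using C0 R hR by auto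
    have "J * (1 / 2) \<le> J * ln 2" using J ln_2_ge_half by (intro mult_left_mono) auto
    then have J5: "J \<le> 7 * h" using Jh h by linarith
    have J4: "J * ln 2 \<le> 4 * h" using Jh h by linarith
    define T where "T = 2 * J * ln 2 / R"
    define l where "l = ln (4 * J) + 2 * J * ln 2 / R"
    have "ln (4 * J) \<le> ln (28 * h)" using J5 J by simp
    then have lnJ: "ln (4 * J) \<le> ln 28 + ln h" using h by (simp add: ln_mult)
    have hp: "h powr a > 0" using h by simp
    have "2 * J * ln 2 / R \<le> (8 / C0) * h powr a"
    proof -
      have "2 * J * ln 2 / R \<le> 8 * h / R" using J4 R C0 by (intro divide_right_mono) auto
      also have "\<dots> \<le> 8 * h / (C0 * h powr (1 - a))"
        using R h C0 by (intro divide_left_mono) (auto simp: a_def)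
      also have "\<dots> = (8 / C0) * h powr a" using h C0 by (simp add: powr_diff field_simps)
      finally show ?thesis .
    qed
    also have "\<dots> \<le> (\<delta> / 4) * h powr a"
      using C0 \<delta> hp by (intro mult_right_mono) (auto simp: field_simps)
    finally have t: "T \<le> (\<delta> * h powr a) / 4" by (simp add: T_def)
    have "ln 2 + 2 * (ln 28 + ln h) \<le> (\<delta> * h powr a) / 2"
    proof -
      have "ln h \<le> h powr (a / 2) / (a / 2)" using h a by (intro ln_powr_bound) auto
      then have "ln 2 + 2 * (ln 28 + ln h) \<le> E + (4 / a) * h powr (a / 2)" by (simp add: E_def)
      also have "\<dots> = (E * h powr (- a) + (4 / a) * h powr (- (a / 2))) * h powr a"
        using h by (simp add: algebra_simps flip: powr_add)
      also have "\<dots> \<le> (\<delta> / 2) * h powr a" using H0[OF h(1)] hp by (intro mult_right_mono) auto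
      finally show ?thesis by simp
    qed
    moreover have "l = ln (4 * J) + T" by (simp add: l_def T_def)
    ultimately have l2: "ln 2 + 2 * l \<le> \<delta> * h powr a" using lnJ t by argo
    have l0: "ln (4 * J) \<ge> 0" using J by simp
    have t0: "2 * J * ln 2 / R \<ge> 0" using J R C0 by simp
    have lpos: "0 \<le> ln 2 + 2 * l" using l0 t0 by (simp add: l_def)
    have "h powr a \<le> h powr 1" using a h by (intro powr_mono) auto
    then have "\<delta> * h powr a \<le> (1/16) * h" using \<delta> h by (intro mult_mono) auto
    then have l1: "2 * l \<le> h / 16" using l2 ln_gt_zero[of 2] by linarith
    have "(ln 2 + 2 * l) powr C \<le> (\<delta> * h powr a) powr C"
      using l2 lpos C by (intro powr_mono2) auto
    also have "\<dots> = \<delta> powr C * h" using \<delta> h C by (simp add: powr_mult powr_powr a_def)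
    finally have "c * (ln 2 + 2 * l) powr C \<le> (c * \<delta> powr C) * h"
      using c by (simp add: mult.assoc)
    also have "\<dots> \<le> (1 / 16) * h" using \<delta>C h by (intro mult_right_mono) auto
    finally have pw: "c * (ln 2 + 2 * l) powr C \<le> h / 16" by simp
    have "2 * ln (4 * J) \<le> 2 * l" using t0 by (simp add: l_def)
    then have "2 * ln (4 * J) + 2 * (c * (ln 2 + 2 * l) powr C) + 2 * l + J * ln 2 / 81 < h"
      using l1 pw J4 h by linarith
    then show "2 * ln (4 * J) + 2 * (c * (ln 2 + 2 * (ln (4 * J) + 2 * J * ln 2 / R)) powr C)
         + 2 * (ln (4 * J) + 2 * J * ln 2 / R) + J * ln 2 / 81 < h" by (simp only: l_def)
  qed
qed

text \<open>The right side is \<open>1 + 3 * (P - 1)\<close>, the factor that appears in the lower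
  bound for a peaked weight. For \<open>P \<ge> 2\<close> it dominates \<open>2 * P\<close>; for
  smaller \<open>P\<close> the square suffices, because \<open>(P - 1) * (2 - P)\<close> is
  nonnegative.\<close>

lemma powr_le_linear:
  fixes P :: real
  assumes P: "P \<ge> 1" "P powr r \<le> 2" and r: "r \<le> 1"
  shows "P powr (1 + r) \<le> 3 * P - 2"
proof (cases "P \<ge> 2")
  case True
  have "P powr (1 + r) = P * P powr r" using P by (simp add: powr_add)
  also have "\<dots> \<le> P * 2" using P by (intro mult_left_mono) auto
  finally show ?thesis using True by linarith
next
  case False
  have "P powr (1 + r) \<le> P powr 2" using P r by (intro powr_mono) auto
  also have "\<dots> = P * P" using P by (simp add: power2_eq_square)
  finally show ?thesis using mult_nonneg_nonneg[of "P - 1" "2 - P"] P False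
    by (simp add: algebra_simps)
qed

text \<open>Off the peak, \<open>p x powr (s - 1)\<close> is at least \<open>81 powr (1 - s)\<close>
  times its value at the peak. Since \<open>81 powr (1 / 4) = 3\<close>, the mass
  \<open>1 - p m\<close> off the peak counts threefold. This is the origin of the number
  \<open>81\<close>.\<close>

lemma powr_sum_ge_of_peak:
  fixes p :: "'a \<Rightarrow> real"
  assumes S: "finite S" "m \<in> S" and p: "\<And>x. x \<in> S \<Longrightarrow> p x \<ge> 0" "(\<Sum>x\<in>S. p x) = 1" "p m > 0"
    and gap: "\<And>x. x \<in> S \<Longrightarrow> x \<noteq> m \<Longrightarrow> p x \<le> p m / 81" and s: "s \<le> 3 / 4"
  shows "p m powr s * (1 + 3 * (1 / p m - 1)) \<le> (\<Sum>x\<in>S. p x powr s)"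
proof -
  have 81: "(81::real) powr (1 - s) \<ge> 3"
  proof -
    have "(81::real) = 3 powr 4" by simp
    then have "(81::real) powr (1/4) = 3" by (simp only: powr_powr) simp
    moreover have "(81::real) powr (1/4) \<le> 81 powr (1 - s)" using s by (intro powr_mono) auto
    ultimately show ?thesis by simp
  qed
  have le: "3 * p m powr (s - 1) * p x \<le> p x powr s" if x: "x \<in> S - {m}" for x
  proof (cases "p x = 0")
    case False
    then have px: "p x > 0" using p(1)[of x] x by auto
    have "3 * p m powr (s - 1) \<le> 81 powr (1 - s) * p m powr (s - 1)"
      using 81 by (intro mult_right_mono) auto
    also have "\<dots> = (p m / 81) powr (s - 1)" using p(3) by (simp add: powr_divide powr_diff)
    also have "\<dots> \<le> p x powr (s - 1)" using gap[of x] x px s by (intro powr_mono2') auto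
    finally have "3 * p m powr (s - 1) * p x \<le> p x powr (s - 1) * p x"
      using px by (intro mult_right_mono) auto
    also have "\<dots> = p x powr s" using px by (simp add: powr_diff)
    finally show ?thesis .
  qed simp
  have "p m powr s * (1 + 3 * (1 / p m - 1)) = p m powr s + 3 * p m powr (s - 1) * (1 - p m)"
    using p(3) by (simp add: powr_diff field_simps)
  also have "1 - p m = (\<Sum>x\<in>S - {m}. p x)" using p(2) S by (simp add: sum_diff1)
  also have "p m powr s + 3 * p m powr (s - 1) * (\<Sum>x\<in>S - {m}. p x)
    \<le> p m powr s + (\<Sum>x\<in>S - {m}. p x powr s)"
    unfolding sum_distrib_left using le by (intro add_left_mono sum_mono)
  also have "\<dots> = (\<Sum>x\<in>S. p x powr s)" using S by (simp add: sum.remove)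
  finally show ?thesis .
qed

text \<open>Values up to \<open>1 / 2 ^ J\<close> carry at most half of the mass, by the hypothesis
  on the sum of powers. The other half is spread over \<open>J\<close> dyadic scales, so one scale
  carries \<open>1 / (2 * J)\<close>; a further factor \<open>2\<close> is lost by rounding values
  down to the threshold.\<close>

lemma large_level_set:
  fixes p :: "'a \<Rightarrow> real"
  assumes S: "finite S" and p: "\<And>x. x \<in> S \<Longrightarrow> 0 \<le> p x \<and> p x \<le> 1" "(\<Sum>x\<in>S. p x) = 1"
    and s: "s \<le> 3 / 4" and J: "J \<ge> 1"
    and B: "(1 / 2 ^ J) powr (1 / 4) * (\<Sum>x\<in>S. p x powr s) \<le> 1 / 2"
  shows "\<exists>t. 1 / 2 ^ J \<le> t \<and> 1 / (4 * real J) \<le> t * real (card {x \<in> S. t \<le> p x})"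
proof (rule ccontr)
  assume contra: "\<not> ?thesis"
  define t :: "nat \<Rightarrow> real" where "t = (\<lambda>i. 1 / 2 ^ Suc i)"
  have small: "t i * real (card {x \<in> S. t i \<le> p x}) < 1 / (4 * real J)" if "i < J" for i
  proof -
    have "(2::real) ^ Suc i \<le> 2 ^ J" using that by (intro power_increasing) auto
    then have "1 / 2 ^ J \<le> t i" by (simp add: t_def field_simps)
    then have "\<not> 1 / (4 * real J) \<le> t i * real (card {x \<in> S. t i \<le> p x})"
      using contra by blast
    then show ?thesis by simp
  qed
  have pt: "p x \<le> (\<Sum>i<J. 2 * t i * of_bool (t i \<le> p x)) + (1 / 2 ^ J) powr (1 / 4) * p x powr s"
    if x: "x \<in> S" for x
  proof (cases "p x \<le> 1 / 2 ^ J")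
    case True
    have "p x = p x powr s * p x powr (1 - s)" using p(1)[OF x] by (simp flip: powr_add)
    also have "p x powr (1 - s) \<le> (1 / 2 ^ J) powr (1 - s)"
      using p(1)[OF x] True s by (intro powr_mono2) auto
    also have "(1 / 2 ^ J :: real) powr (1 - s) \<le> (1 / 2 ^ J) powr (1 / 4)"
      using s by (intro powr_mono') auto
    finally have "p x \<le> p x powr s * (1 / 2 ^ J) powr (1 / 4)"
      by (simp add: mult_left_mono)
    moreover have "(\<Sum>i<J. 2 * t i * of_bool (t i \<le> p x)) \<ge> 0"
      by (intro sum_nonneg) (simp add: t_def)
    ultimately show ?thesis by (simp add: mult.commute)
  next
    case False
    \<comment> \<open>The first threshold not exceeding \<open>p x\<close>; it is within a factor
      \<open>2\<close> of \<open>p x\<close>, where the case \<open>i = 0\<close> uses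
      \<open>p x \<le> 1\<close>.\<close>
    define i where "i = (LEAST i. t i \<le> p x)"
    obtain k where k: "J = Suc k" using J by (cases J) auto
    have ex: "t k \<le> p x" using False by (simp add: t_def k)
    have i: "t i \<le> p x" unfolding i_def using ex by (rule LeastI[of "\<lambda>i. t i \<le> p x"])
    have iJ: "i < J" using Least_le[of "\<lambda>i. t i \<le> p x", OF ex] by (simp add: i_def k)
    have "p x \<le> 2 * t i"
    proof (cases i)
      case 0
      then show ?thesis using p(1)[OF x] by (simp add: t_def)
    next
      case (Suc j)
      then have "\<not> t j \<le> p x" using not_less_Least[of j "\<lambda>i. t i \<le> p x"] by (simp add: i_def)
      then show ?thesis using Suc by (simp add: t_def)
    qed
    also have "\<dots> = 2 * t i * of_bool (t i \<le> p x)" using i by simp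
    also have "\<dots> \<le> (\<Sum>i<J. 2 * t i * of_bool (t i \<le> p x))"
      using iJ by (intro member_le_sum) (auto simp: t_def)
    finally show ?thesis by (smt (verit) powr_ge_zero mult_nonneg_nonneg)
  qed
  have "1 \<le> (\<Sum>x\<in>S. (\<Sum>i<J. 2 * t i * of_bool (t i \<le> p x)) + (1 / 2 ^ J) powr (1 / 4) * p x powr s)"
    by (subst p(2)[symmetric]) (use pt in \<open>intro sum_mono\<close>)
  also have "\<dots> = (\<Sum>x\<in>S. \<Sum>i<J. 2 * t i * of_bool (t i \<le> p x))
      + (1 / 2 ^ J) powr (1 / 4) * (\<Sum>x\<in>S. p x powr s)"
    by (simp add: sum.distrib sum_distrib_left)
  also have "(\<Sum>x\<in>S. \<Sum>i<J. 2 * t i * of_bool (t i \<le> p x)) = (\<Sum>i<J. \<Sum>x\<in>S. 2 * t i * of_bool (t i \<le> p x))"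
    by (rule sum.swap)
  also have "\<dots> = (\<Sum>i<J. 2 * (t i * real (card {x \<in> S. t i \<le> p x})))"
    using S by (intro sum.cong) (auto simp: sum_distrib_left[symmetric] of_bool_def sum.If_cases Int_def)
  also have "\<dots> < (\<Sum>i<J. 2 * (1 / (4 * real J)))"
    using small J by (intro sum_strict_mono mult_strict_left_mono) (auto simp: lessThan_empty_iff)
  also have "\<dots> = 1 / 2" using J by simp
  finally show False using B by simp
qed

section \<open>The sparse case: a lower and an upper bound for the min-entropy\<close>

text \<open>The condition \<open>sparse\<close> is the failure of every pair of fibres to be economical, with \<open>W\<close> the
  distribution of the sumset; \<open>minimal\<close> says that passing to a further quotient does not pay off.\<close>
locale sparse_pair =
  fixes n :: nat and p q W :: "(nat \<Rightarrow> bit) \<Rightarrow> real" and m m' :: "nat \<Rightarrow> bit" and R :: real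
  assumes nonneg: "\<And>x. p x \<ge> 0" "\<And>x. q x \<ge> 0" "\<And>x. W x \<ge> 0"
    and total: "(\<Sum>x\<in>coord_space n. p x) = 1" "(\<Sum>x\<in>coord_space n. q x) = 1"
      "(\<Sum>x\<in>coord_space n. W x) \<le> 1"
    and mode: "m \<in> coord_space n" "m' \<in> coord_space n" "p m > 0" "q m' > 0"
    and minimal: "\<And>V (x :: nat \<Rightarrow> bit) (y :: nat \<Rightarrow> bit). \<lbrakk>fun_vs.subspace V; V \<subseteq> coord_space n; x \<in> coord_space n; y \<in> coord_space n\<rbrakk>
      \<Longrightarrow> (\<Sum>v\<in>V. p (x + v)) * (\<Sum>v\<in>V. q (y + v)) \<le> p m * q m' * real (card V) powr (1 / 81)"
    and sparse: "\<And>x y. \<lbrakk>x \<in> coord_space n; y \<in> coord_space n; p x > 0; q y > 0\<rbrakk>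
      \<Longrightarrow> (p x * q y) powr (1 / 2 + 1 / R) < W (x + y)"
    and R4: "R \<ge> 4"
begin

text \<open>Allows every fact proved about \<open>p\<close> to be read for \<open>q\<close> by
  interpreting the locale with the roles exchanged.\<close>

lemma swap: "sparse_pair n q p W m' m R"
proof
  show "(\<Sum>v\<in>V. q (x + v)) * (\<Sum>v\<in>V. p (y + v)) \<le> q m' * p m * real (card V) powr (1 / 81)"
    if "fun_vs.subspace V" "V \<subseteq> coord_space n" "x \<in> coord_space n" "y \<in> coord_space n"
    for V and x y :: "nat \<Rightarrow> bit"
    using minimal[OF that(1,2,4,3)] by (simp add: mult.commute)
  show "(q x * p y) powr (1 / 2 + 1 / R) < W (x + y)"
    if "x \<in> coord_space n" "y \<in> coord_space n" "q x > 0" "p y > 0" for x y :: "nat \<Rightarrow> bit"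
    using sparse[OF that(2,1,4,3)] by (simp add: mult.commute add.commute)
qed (use nonneg total mode R4 in auto)

abbreviation "s \<equiv> 1 / 2 + 1 / R"

lemma s_bounds: "1 / 2 < s" "s \<le> 3 / 4" "s > 0"
  using R4 by (auto simp: field_simps)

lemma p_le_mode: "x \<in> coord_space n \<Longrightarrow> p x \<le> p m"
  using minimal[of "{0}" x m'] mode by (simp add: subspace_bit_iff)

text \<open>Minimality for the subgroup \<open>{0, m + x}\<close> puts \<open>p m + p x\<close>
  below \<open>2 powr (1 / 81) * p m\<close>, and Bernoulli's inequality bounds that factor by
  \<open>1 + 1 / 81\<close>.\<close>

lemma p_gap:
  assumes x: "x \<in> coord_space n" "x \<noteq> m"
  shows "p x \<le> p m / 81"
proof -
  define V where "V = {0, m + x}"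
  have ne: "m + x \<noteq> 0" using x by (auto simp: bit_fun_add_eq_0_iff)
  have V: "fun_vs.subspace V" "V \<subseteq> coord_space n"
    using x mode by (auto simp: V_def subspace_bit_iff coord_space_add)
  have "(\<Sum>v\<in>V. p (m + v)) = p m + p x" using ne by (simp add: V_def)
  moreover have "(\<Sum>v\<in>V. q (m' + v)) = q m' + q (m' + (m + x))" using ne by (simp add: V_def)
  moreover have "card V = 2" using ne by (simp add: V_def)
  ultimately have "(p m + p x) * (q m' + q (m' + (m + x))) \<le> p m * q m' * 2 powr (1 / 81)"
    using minimal[OF V mode(1,2)] by simp
  moreover have "(p m + p x) * q m' \<le> (p m + p x) * (q m' + q (m' + (m + x)))"
    using nonneg by (intro mult_left_mono) auto
  ultimately have "(p m + p x) * q m' \<le> (p m * 2 powr (1 / 81)) * q m'" by (simp add: ac_simps)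
  then have "p m + p x \<le> p m * 2 powr (1 / 81)" using mode by simp
  also have "\<dots> \<le> p m * (1 + 1 / 81)"
  proof (intro mult_left_mono)
    have "1 + of_nat 81 * (1 / 81) \<le> (1 + 1 / 81 :: real) ^ 81" by (rule Bernoulli_inequality) simp
    then have "(2::real) powr (1 / 81) \<le> ((1 + 1 / 81) ^ 81) powr (1 / 81)"
      by (intro powr_mono2) auto
    also have "\<dots> = 1 + 1 / 81"
      by (subst powr_realpow[symmetric], simp) (simp only: powr_powr, simp)
    finally show "(2::real) powr (1 / 81) \<le> 1 + 1 / 81" .
  qed (use mode in auto)
  finally show ?thesis by (simp add: field_simps)
qed

text \<open>The sparse condition is summed over all \<open>x\<close> with \<open>y = m'\<close>
  fixed. The points \<open>x + m'\<close> are distinct, so \<open>W\<close> contributes at most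
  \<open>1\<close>; strictness comes from \<open>x = m\<close>.\<close>

lemma sum_powr_less: "q m' powr s * (\<Sum>x\<in>coord_space n. p x powr s) < 1"
proof -
  have "q m' powr s * (\<Sum>x\<in>coord_space n. p x powr s) = (\<Sum>x\<in>coord_space n. (p x * q m') powr s)"
    using nonneg by (simp add: sum_distrib_left powr_mult mult.commute)
  also have "\<dots> < (\<Sum>x\<in>coord_space n. W (x + m'))"
  proof (rule sum_strict_mono_ex1)
    show "\<forall>x\<in>coord_space n. (p x * q m') powr s \<le> W (x + m')"
    proof
      fix x :: "nat \<Rightarrow> bit" assume x: "x \<in> coord_space n"
      show "(p x * q m') powr s \<le> W (x + m')"
        using sparse[OF x mode(2) _ mode(4)] nonneg(1)[of x] nonneg(3)[of "x + m'"]
        by (cases "p x = 0") (auto simp: less_imp_le)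
    qed
    show "\<exists>x\<in>coord_space n. (p x * q m') powr s < W (x + m')"
      using sparse[OF mode] mode by blast
  qed simp
  also have "\<dots> = (\<Sum>z\<in>(\<lambda>x. x + m') ` coord_space n. W z)"
    by (simp add: sum.reindex inj_on_def)
  also have "\<dots> \<le> (\<Sum>z\<in>coord_space n. W z)"
    using mode nonneg by (intro sum_mono2) (auto simp: coord_space_add)
  finally show ?thesis using total by linarith
qed

lemma p_mode_le_1: "p m \<le> 1"
  using member_le_sum[of m "coord_space n" p] mode nonneg total by simp

text \<open>Otherwise the linear bound for \<open>(1 / p m) powr (1 + 2 / R)\<close> and the peak
  inequality show that \<open>p m powr s\<close> times the sum of \<open>p x powr s\<close> is at
  least \<open>1\<close>. Replacing \<open>p m\<close> by the larger \<open>q m'\<close> contradicts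
  the bound just obtained from sparsity.\<close>

lemma p_mode_small:
  assumes "p m \<le> q m'"
  shows "(1 / p m) powr (2 / R) > 2"
proof (rule ccontr)
  assume "\<not> (1 / p m) powr (2 / R) > 2"
  then have *: "(1 / p m) powr (1 + 2 / R) \<le> 3 * (1 / p m) - 2"
    using R4 p_mode_le_1 mode by (intro powr_le_linear) (auto simp: field_simps)
  have s2: "s + s = 1 + 2 / R" by (simp add: field_simps)
  have "1 = p m powr (1 + 2 / R) * (1 / p m) powr (1 + 2 / R)"
    using mode by (simp flip: powr_mult)
  also have "\<dots> \<le> p m powr (1 + 2 / R) * (1 + 3 * (1 / p m - 1))"
    using * by (intro mult_left_mono) auto
  also have "\<dots> = p m powr s * (p m powr s * (1 + 3 * (1 / p m - 1)))"
    by (simp only: s2[symmetric] powr_add mult.assoc)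
  also have "\<dots> \<le> q m' powr s * (\<Sum>x\<in>coord_space n. p x powr s)"
  proof (intro mult_mono)
    show "p m powr s \<le> q m' powr s" using assms mode s_bounds by (intro powr_mono2) auto
    show "p m powr s * (1 + 3 * (1 / p m - 1)) \<le> (\<Sum>x\<in>coord_space n. p x powr s)"
      using p_gap mode nonneg total s_bounds by (intro powr_sum_ge_of_peak) auto
    show "0 \<le> p m powr s * (1 + 3 * (1 / p m - 1))"
      using p_mode_le_1 mode by (intro mult_nonneg_nonneg) (auto simp: field_simps)
  qed auto
  finally show False using sum_powr_less by linarith
qed

lemma entropy_large_aux:
  assumes "p m \<le> q m'"
  shows "ln (1 / (p m * q m')) > R / 4"
proof -
  interpret sw: sparse_pair n q p W m' m R by (rule swap)
  have "ln 2 < ln ((1 / p m) powr (2 / R))"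
    using p_mode_small[OF assms] by (subst ln_less_cancel_iff) auto
  then have "ln 2 < (2 / R) * ln (1 / p m)" using mode by (simp add: ln_powr)
  then have "R * ln 2 < 2 * ln (1 / p m)" using R4 by (simp add: field_simps)
  moreover have "R * (1 / 2) \<le> R * ln 2" using R4 ln_2_ge_half by (intro mult_left_mono) auto
  moreover have "ln (1 / (p m * q m')) = ln (1 / p m) + ln (1 / q m')"
    using mode by (simp add: ln_div ln_mult)
  moreover have "ln (1 / q m') \<ge> 0" using sw.p_mode_le_1 mode by simp
  ultimately show ?thesis by linarith
qed

lemma entropy_large: "ln (1 / (p m * q m')) > R / 4"
proof (cases "p m \<le> q m'")
  case False
  interpret sw: sparse_pair n q p W m' m R by (rule swap)
  show ?thesis using sw.entropy_large_aux False by (simp add: mult.commute)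
qed (rule entropy_large_aux)

text \<open>The condition on \<open>J\<close> says that \<open>(1 / 2 ^ J) powr (1 / 4)\<close> is
  at most half of \<open>q m' powr (3 / 4)\<close>, hence at most half of
  \<open>q m' powr s\<close>; the sum of powers is then small enough to find a level set.\<close>

lemma level_set:
  assumes J: "J \<ge> 1" "16 / q m' ^ 3 \<le> 2 ^ J"
  shows "\<exists>t. 1 / 2 ^ J \<le> t \<and> 1 / (4 * real J) \<le> t * real (card {x \<in> coord_space n. t \<le> p x})"
proof (rule large_level_set[of "coord_space n" p s J])
  show "0 \<le> p x \<and> p x \<le> 1" if "x \<in> coord_space n" for x :: "nat \<Rightarrow> bit"
    using p_le_mode[OF that] p_mode_le_1 nonneg by auto
  interpret sw: sparse_pair n q p W m' m R by (rule swap)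
  define b where "b = q m'"
  have b: "0 < b" "b \<le> 1" using mode sw.p_mode_le_1 by (auto simp: b_def)
  have "(1 / 2 ^ J) powr (1 / 4) \<le> ((b / 2) powr 3 * (1/2) powr 1) powr (1 / 4)"
    using J b by (intro powr_mono2) (auto simp: b_def field_simps power3_eq_cube)
  also have "\<dots> = b powr (3/4) * ((1/2) powr 3 * (1/2) powr 1) powr (1 / 4)"
    using b by (simp add: powr_mult powr_powr powr_divide flip: powr_numeral)
  also have "((1/2::real) powr 3 * (1/2) powr 1) powr (1 / 4) = 1 / 2"
    by (simp only: powr_add[symmetric] powr_powr) simp
  also have "b powr (3/4) \<le> b powr s" using b s_bounds by (intro powr_mono') auto
  finally have "(1 / 2 ^ J) powr (1 / 4) \<le> b powr s * (1 / 2)" by simp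
  then have "(1 / 2 ^ J) powr (1 / 4) * (\<Sum>x\<in>coord_space n. p x powr s)
    \<le> (b powr s * (1 / 2)) * (\<Sum>x\<in>coord_space n. p x powr s)"
    by (intro mult_right_mono sum_nonneg) auto
  also have "\<dots> \<le> 1 / 2" using sum_powr_less by (simp add: b_def)
  finally show "(1 / 2 ^ J) powr (1 / 4) * (\<Sum>x\<in>coord_space n. p x powr s) \<le> 1 / 2" .
qed (use total J s_bounds in auto)

text \<open>Large level sets \<open>P\<close>, \<open>Q\<close> of \<open>p\<close>,
  \<open>q\<close> have a small sumset by sparsity, with ratio \<open>M = exp l\<close>. Cosets of a
  subspace \<open>V\<close> then hold a large share of both, while minimality bounds the product of
  their masses by \<open>p m * q m' * |V| powr (1 / 81)\<close>. Taking logarithms gives the four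
  terms.\<close>

lemma entropy_bound:
  assumes adm: "admissible_PFR C\<^sub>P c" and J: "J \<ge> 1" "16 / (p m * q m') ^ 3 \<le> 2 ^ J"
  defines "l \<equiv> ln (4 * real J) + 2 * real J * ln 2 / R"
  shows "ln (1 / (p m * q m')) \<le> 2 * ln (4 * real J) + 2 * (c * (ln 2 + 2 * l) powr C\<^sub>P)
    + 2 * l + real J * ln 2 / 81"
proof -
  interpret sw: sparse_pair n q p W m' m R by (rule swap)
  have J0: "real J > 0" using J by simp
  have cube: "b * c > 0 \<Longrightarrow> 0 \<le> b \<Longrightarrow> b \<le> 1 \<Longrightarrow> c \<ge> 0 \<Longrightarrow> 16 / c ^ 3 \<le> 16 / (b * c) ^ 3" for b c :: real
    by (intro divide_left_mono power_mono mult_left_le_one_le mult_pos_pos zero_less_power)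
       (auto simp: zero_less_mult_iff)
  have "16 / q m' ^ 3 \<le> 2 ^ J"
    using cube[of "p m" "q m'"] p_mode_le_1 mode J by simp
  then obtain t where t: "1 / 2 ^ J \<le> t" "1 / (4 * real J) \<le> t * real (card {x \<in> coord_space n. t \<le> p x})"
    using level_set[OF J(1)] by blast
  have "16 / p m ^ 3 \<le> 2 ^ J"
    using cube[of "q m'" "p m"] sw.p_mode_le_1 mode J by (simp add: mult.commute)
  then obtain u where u: "1 / 2 ^ J \<le> u" "1 / (4 * real J) \<le> u * real (card {x \<in> coord_space n. u \<le> q x})"
    using sw.level_set[OF J(1)] by blast
  define P Q where "P = {x \<in> coord_space n. t \<le> p x}" and "Q = {x \<in> coord_space n. u \<le> q x}"
  have "0 < 1 / (2::real) ^ J" by simp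
  then have tu: "t > 0" "u > 0" using t(1) u(1) by linarith+
  have sub: "P \<subseteq> coord_space n" "Q \<subseteq> coord_space n" by (auto simp: P_def Q_def)
  have fin: "finite P" "finite Q" using sub by (auto intro: finite_subset[OF _ finite_coord_space_bit])
  have tP: "1 / (4 * real J) \<le> t * real (card P)" and uQ: "1 / (4 * real J) \<le> u * real (card Q)"
    using t u by (auto simp: P_def Q_def)
  have J4: "0 < 1 / (4 * real J)" using J0 by simp
  have "real (card P) > 0" "real (card Q) > 0"
    using tP uQ tu J4 by (smt (verit) mult_nonneg_nonpos)+
  then have pos: "card P > 0" "card Q > 0" and ne: "P \<noteq> {}" "Q \<noteq> {}" by auto
  have PQ: "real (card (P + Q)) * (t * u) powr s \<le> 1"
  proof -
    have "real (card (P + Q)) * (t * u) powr s = (\<Sum>z\<in>P + Q. (t * u) powr s)" by simp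
    also have "\<dots> \<le> (\<Sum>z\<in>P + Q. W z)"
    proof (rule sum_mono)
      fix z assume "z \<in> P + Q"
      then obtain x y where xy: "x \<in> P" "y \<in> Q" "z = x + y" by (auto elim: set_plus_elim)
      have le: "t \<le> p x" "u \<le> q y" using xy by (auto simp: P_def Q_def)
      then have px: "p x > 0" "q y > 0" using tu by auto
      have "(t * u) powr s \<le> (p x * q y) powr s"
        using le tu px s_bounds by (intro powr_mono2 mult_mono) auto
      also have "\<dots> < W z" using sparse[of x y] xy px sub by auto
      finally show "(t * u) powr s \<le> W z" by simp
    qed
    also have "\<dots> \<le> (\<Sum>z\<in>coord_space n. W z)"
      using sub nonneg by (intro sum_mono2) (auto elim!: set_plus_elim intro!: coord_space_add)
    finally show ?thesis using total by linarith
  qed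
  \<comment> \<open>The factor \<open>4 * J\<close> comes from \<open>t * |P|\<close> and
    \<open>u * |Q|\<close> being at least \<open>1 / (4 * J)\<close>, the other from
    \<open>(t * u) powr (1 / R)\<close> with both thresholds at least
    \<open>1 / 2 ^ J\<close>.\<close>
  define M where "M = 4 * real J * 2 powr (2 * real J / R)"
  have M0: "M > 0" using J0 by (simp add: M_def)
  have lnM: "ln M = l" using J0 by (simp add: M_def l_def ln_mult ln_powr)
  have M: "real (card (P + Q)) \<le> M * sqrt (real (card P) * real (card Q))"
  proof -
    have tu0: "t * u > 0" using tu by simp
    have "1 / (4 * real J) * (1 / (4 * real J)) \<le> (t * real (card P)) * (u * real (card Q))"
      by (intro mult_mono tP uQ) (use tu J4 in auto)
    then have "sqrt ((1 / (4 * real J))\<^sup>2) \<le> sqrt ((t * u) * (real (card P) * real (card Q)))"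
      by (intro real_sqrt_le_mono) (simp add: power2_eq_square ac_simps)
    then have "1 / (4 * real J) \<le> sqrt (t * u) * sqrt (real (card P) * real (card Q))"
      using J4 by (simp only: real_sqrt_mult real_sqrt_abs abs_of_pos)
    then have 1: "1 \<le> 4 * real J * (sqrt (t * u) * sqrt (real (card P) * real (card Q)))"
      using J0 by (simp add: field_simps)
    have "(1 / 2 ^ J) * (1 / 2 ^ J) \<le> t * u" using t u tu by (intro mult_mono) auto
    moreover have "(1 / 2 ^ J) * (1 / 2 ^ J) = (2::real) powr (- (2 * real J))"
    proof -
      have "(2::real) powr (2 * real J) = 2 ^ (J + J)" by (subst powr_realpow[symmetric]) auto
      then show ?thesis by (simp add: powr_minus power_add field_simps)
    qed
    ultimately have "(2 powr (- (2 * real J))) powr (1 / R) \<le> (t * u) powr (1 / R)"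
      using R4 by (intro powr_mono2) auto
    then have "2 powr (- (2 * real J / R)) \<le> (t * u) powr (1 / R)" by (simp add: powr_powr)
    then have 2: "1 \<le> 2 powr (2 * real J / R) * (t * u) powr (1 / R)"
      by (simp add: powr_minus field_simps)
    have "(t * u) powr s = sqrt (t * u) * (t * u) powr (1 / R)"
      using tu0 by (simp add: powr_add powr_half_sqrt)
    then have "1 \<le> M * sqrt (real (card P) * real (card Q)) * (t * u) powr s"
      using mult_mono[OF 1 2] J0 tu0 by (simp add: M_def ac_simps)
    then have "real (card (P + Q)) * (t * u) powr s \<le> M * sqrt (real (card P) * real (card Q)) * (t * u) powr s"
      using PQ by linarith
    then show ?thesis using tu by (simp add: mult_le_cancel_right)
  qed
  define N where "N = exp (c * ln (2 * M\<^sup>2) powr C\<^sub>P)"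
  have N0: "N > 0" by (simp add: N_def)
  have lnN: "ln N = c * (ln 2 + 2 * l) powr C\<^sub>P"
    using M0 by (simp add: N_def ln_mult ln_realpow lnM)
  obtain V x y where V: "fun_vs.subspace V" "V \<subseteq> coord_space n" "card V \<le> card P"
    "x \<in> coord_space n" "y \<in> coord_space n"
    "real (card P) \<le> N * real (card (P \<inter> (x +o V)))"
    "real (card Q) \<le> N * M\<^sup>2 * real (card (Q \<inter> (y +o V)))"
    using admissible_pair[OF adm sub ne M N_def] .
  have finV: "finite V" using V by (auto intro: finite_subset[OF _ finite_coord_space_bit])
  have mass: "t * real (card (S \<inter> (x +o V))) \<le> (\<Sum>v\<in>V. f (x + v))"
    if f: "\<And>z. f z \<ge> 0" "S = {z \<in> coord_space n. t \<le> f z}" for f :: "(nat \<Rightarrow> bit) \<Rightarrow> real" and S t x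
  proof -
    have xV: "x +o V = (\<lambda>v. x + v) ` V" by (auto simp: elt_set_plus_def)
    have "t * real (card (S \<inter> (x +o V))) = (\<Sum>z\<in>S \<inter> (x +o V). t)" by simp
    also have "\<dots> \<le> (\<Sum>z\<in>S \<inter> (x +o V). f z)" using f by (intro sum_mono) auto
    also have "\<dots> \<le> (\<Sum>z\<in>x +o V. f z)" using f finV xV by (intro sum_mono2) auto
    also have "\<dots> = (\<Sum>v\<in>V. f (x + v))" unfolding xV by (subst sum.reindex) (auto simp: inj_on_def)
    finally show ?thesis .
  qed
  have mp: "1 / (4 * real J) \<le> N * (\<Sum>v\<in>V. p (x + v))"
  proof -
    have "t * real (card P) \<le> t * (N * real (card (P \<inter> (x +o V))))"
      using V tu by (intro mult_left_mono) auto
    also have "\<dots> = N * (t * real (card (P \<inter> (x +o V))))" by simp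
    also have "\<dots> \<le> N * (\<Sum>v\<in>V. p (x + v))"
      using mass[of p P t x] nonneg N0 by (intro mult_left_mono) (auto simp: P_def)
    finally show ?thesis using tP by linarith
  qed
  have mq: "1 / (4 * real J) \<le> N * M\<^sup>2 * (\<Sum>v\<in>V. q (y + v))"
  proof -
    have "u * real (card Q) \<le> u * (N * M\<^sup>2 * real (card (Q \<inter> (y +o V))))"
      using V tu by (intro mult_left_mono) auto
    also have "\<dots> = N * M\<^sup>2 * (u * real (card (Q \<inter> (y +o V))))" by simp
    also have "\<dots> \<le> N * M\<^sup>2 * (\<Sum>v\<in>V. q (y + v))"
      using mass[of q Q u y] nonneg N0 by (intro mult_left_mono) (auto simp: Q_def)
    finally show ?thesis using uQ by linarith
  qed
  \<comment> \<open>Total mass \<open>1\<close> above a threshold of at least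
    \<open>1 / 2 ^ J\<close>. This controls \<open>|V|\<close>, which is at most
    \<open>|P|\<close>.\<close>
  have cP: "real (card P) \<le> 2 ^ J"
  proof -
    have "t * real (card P) = (\<Sum>z\<in>P. t)" by simp
    also have "\<dots> \<le> (\<Sum>z\<in>P. p z)" by (intro sum_mono) (auto simp: P_def)
    also have "\<dots> \<le> (\<Sum>z\<in>coord_space n. p z)" using sub nonneg by (intro sum_mono2) auto
    finally have "t * real (card P) \<le> 1" using total by simp
    moreover have "(1 / 2 ^ J) * real (card P) \<le> t * real (card P)"
      using t by (intro mult_right_mono) auto
    ultimately have "(1 / 2 ^ J) * real (card P) \<le> 1" by linarith
    then show ?thesis by (simp add: field_simps)
  qed
  have "1 / (4 * real J) * (1 / (4 * real J))
      \<le> (N * (\<Sum>v\<in>V. p (x + v))) * (N * M\<^sup>2 * (\<Sum>v\<in>V. q (y + v)))"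
    by (intro mult_mono mp mq) (use nonneg N0 J4 in \<open>auto intro!: mult_nonneg_nonneg sum_nonneg\<close>)
  also have "\<dots> = N\<^sup>2 * M\<^sup>2 * ((\<Sum>v\<in>V. p (x + v)) * (\<Sum>v\<in>V. q (y + v)))"
    by (simp add: power2_eq_square)
  also have "\<dots> \<le> N\<^sup>2 * M\<^sup>2 * (p m * q m' * real (card V) powr (1 / 81))"
    using minimal[OF V(1,2,4,5)] by (intro mult_left_mono) auto
  also have "\<dots> \<le> N\<^sup>2 * M\<^sup>2 * (p m * q m' * (2 ^ J) powr (1 / 81))"
    using V(3) cP mode by (intro mult_left_mono powr_mono2) auto
  finally have "1 / (p m * q m') \<le> (4 * real J)\<^sup>2 * N\<^sup>2 * M\<^sup>2 * (2 ^ J) powr (1 / 81)"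
    using mode J0 by (simp add: field_simps power2_eq_square)
  then have "ln (1 / (p m * q m')) \<le> ln ((4 * real J)\<^sup>2 * N\<^sup>2 * M\<^sup>2 * (2 ^ J) powr (1 / 81))"
    using mode J0 N0 M0 by (subst ln_le_cancel_iff) auto
  also have "\<dots> = 2 * ln (4 * real J) + 2 * ln N + 2 * ln M + real J * ln 2 / 81"
  proof -
    have "ln (a\<^sup>2 * b\<^sup>2 * d\<^sup>2 * e) = 2 * ln a + 2 * ln b + 2 * ln d + ln e"
      if "a > 0" "b > 0" "d > 0" "e > 0" for a b d e :: real
      using that by (simp add: ln_mult ln_realpow)
    from this[of "4 * real J" N M "(2 ^ J) powr (1 / 81)"] show ?thesis
      using J0 N0 M0 by (simp add: ln_realpow ln_powr)
  qed
  finally show ?thesis by (simp add: lnM lnN)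
qed

end

text \<open>For \<open>R\<close> this large, \<open>entropy_large\<close> supplies
  \<open>h > R / 4\<close>, and then the upper bound of \<open>entropy_bound\<close> falls strictly
  below \<open>h\<close>.\<close>

lemma sparse_pair_impossible:
  assumes adm: "admissible_PFR C\<^sub>P c"
  obtains C0 :: real where "C0 \<ge> 4"
    "\<And>n p q W m m' R. \<lbrakk>sparse_pair n p q W m m' R; R \<ge> C0;
       R \<ge> C0 * ln (1 / (p m * q m')) powr (1 - 1 / C\<^sub>P)\<rbrakk> \<Longrightarrow> False"
proof -
  have c: "c > 0" using adm by (simp add: admissible_PFR_def)
  obtain C0 :: real where C0: "C0 \<ge> 4"
    "\<And>R h J. \<lbrakk>R \<ge> C0; R \<ge> C0 * h powr (1 - 1 / C\<^sub>P); h > R / 4; J \<ge> 1; J * ln 2 \<le> 3 * h + 4\<rbrakk> \<Longrightarrow>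
       2 * ln (4 * J) + 2 * (c * (ln 2 + 2 * (ln (4 * J) + 2 * J * ln 2 / R)) powr C\<^sub>P)
         + 2 * (ln (4 * J) + 2 * J * ln 2 / R) + J * ln 2 / 81 < h"
    using parameter_choice[OF admissible_exponent_ge_1[OF adm] c] by blast
  show thesis
  proof (rule that[OF C0(1)])
    fix n p q W m m' R
    assume sp: "sparse_pair n p q W m m' R" and R: "R \<ge> C0"
      "R \<ge> C0 * ln (1 / (p m * q m')) powr (1 - 1 / C\<^sub>P)"
    interpret sparse_pair n p q W m m' R by (rule sp)
    define h where "h = ln (1 / (p m * q m'))"
    have h: "h > R / 4" using entropy_large by (simp add: h_def)
    then have h0: "h > 0" using R4 by linarith
    \<comment> \<open>Just large enough for \<open>16 * exp (3 * h) \<le> 2 ^ J\<close>. The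
      \<open>4\<close> from the factor \<open>16\<close> and the \<open>1\<close> from rounding up
      cost \<open>5 * ln 2\<close>, which is at most \<open>4\<close>.\<close>
    define J where "J = nat \<lceil>log 2 (16 * exp (3 * h))\<rceil>"
    have lg: "log 2 (16 * exp (3 * h)) = 4 + 3 * h / ln 2"
    proof -
      have "log 2 (16::real) = log 2 (2 ^ 4)" by simp
      also have "\<dots> = 4" by (subst log_pow_cancel) auto
      finally show ?thesis by (simp add: log_mult)
    qed
    have lg0: "4 + 3 * h / ln 2 \<ge> 4" using h0 by simp
    have Jr: "real J \<ge> 4 + 3 * h / ln 2" "real J \<le> 4 + 3 * h / ln 2 + 1"
      using lg0 unfolding J_def lg by linarith+
    have J1: "J \<ge> 1" using Jr(1) lg0 by linarith
    have "16 * exp (3 * h) = 2 powr (log 2 (16 * exp (3 * h)))" by (simp add: powr_log_cancel)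
    also have "\<dots> \<le> 2 powr (real J)" using Jr(1) by (intro powr_mono) (auto simp: lg)
    finally have "16 * exp (3 * h) \<le> 2 ^ J" by (simp add: powr_realpow)
    moreover have "exp (3 * h) = (1 / (p m * q m')) ^ 3"
      using mode by (simp add: h_def exp_of_nat_mult[of 3, simplified])
    ultimately have J2: "16 / (p m * q m') ^ 3 \<le> 2 ^ J" by (simp add: power_divide)
    have ln2: "ln 2 \<le> (4/5::real)"
    proof -
      have "(2::real) \<le> exp (4/5)" using exp_lower_Taylor_quadratic[of "4/5::real"]
        by (simp add: power2_eq_square)
      then show ?thesis by (metis exp_gt_zero ln_exp ln_le_cancel_iff zero_less_numeral)
    qed
    have "real J * ln 2 \<le> (4 + 3 * h / ln 2 + 1) * ln 2" using Jr by (intro mult_right_mono) auto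
    also have "\<dots> = 5 * ln 2 + 3 * h" by (simp add: algebra_simps)
    finally have "real J * ln 2 \<le> 3 * h + 4" using ln2 by linarith
    from C0(2)[OF R(1) R(2)[folded h_def] h _ this] J1 entropy_bound[OF adm J1 J2]
    show False by (simp add: h_def)
  qed
qed

section \<open>Optimal quotients and a single step of the iteration\<close>

section \<open>Passing to a fibre\<close>

definition fibre_weight :: "'a set \<Rightarrow> ('a \<Rightarrow> 'b) \<Rightarrow> 'b \<Rightarrow> real" where
  "fibre_weight A \<alpha> z = real (card {a \<in> A. \<alpha> a = z}) / real (card A)"

lemma fibre_weight_nonneg [simp]: "fibre_weight A \<alpha> z \<ge> 0"
  by (simp add: fibre_weight_def)

lemma sum_fibre_weight:
  assumes "finite A" "finite S"
  shows "(\<Sum>w\<in>{w \<in> S. Q w}. fibre_weight A \<alpha> w) = real (card {a \<in> A. \<alpha> a \<in> S \<and> Q (\<alpha> a)}) / real (card A)"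
proof -
  have "real (card {a \<in> A. \<alpha> a = w}) = (\<Sum>a\<in>{a \<in> {a \<in> A. \<alpha> a \<in> S \<and> Q (\<alpha> a)}. \<alpha> a = w}. 1)"
    if "w \<in> {w \<in> S. Q w}" for w
    using that by (auto intro!: arg_cong[where f = card])
  then have "(\<Sum>w\<in>{w \<in> S. Q w}. real (card {a \<in> A. \<alpha> a = w}))
    = (\<Sum>w\<in>{w \<in> S. Q w}. \<Sum>a\<in>{a \<in> {a \<in> A. \<alpha> a \<in> S \<and> Q (\<alpha> a)}. \<alpha> a = w}. 1)"
    by (rule sum.cong[OF refl])
  also have "\<dots> = (\<Sum>a\<in>{a \<in> A. \<alpha> a \<in> S \<and> Q (\<alpha> a)}. 1)"
    using assms by (intro sum.group) auto
  finally show ?thesis by (simp add: fibre_weight_def flip: sum_divide_distrib)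
qed

lemma fibre_weight_comp:
  assumes "finite A" "finite S" "\<alpha> ` A \<subseteq> S"
  shows "(\<Sum>w\<in>{w \<in> S. \<pi> w = z}. fibre_weight A \<alpha> w) = fibre_weight A (\<pi> \<circ> \<alpha>) z"
proof -
  have "{a \<in> A. \<alpha> a \<in> S \<and> \<pi> (\<alpha> a) = z} = {a \<in> A. (\<pi> \<circ> \<alpha>) a = z}" using assms(3) by auto
  then show ?thesis using sum_fibre_weight[OF assms(1,2), where Q = "\<lambda>w. \<pi> w = z" and \<alpha> = \<alpha>]
    by (simp only: fibre_weight_def)
qed

lemma fibre_weight_total:
  assumes "finite A" "finite S" "\<alpha> ` A \<subseteq> S" "A \<noteq> {}"
  shows "(\<Sum>w\<in>S. fibre_weight A \<alpha> w) = 1"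
proof -
  have "{a \<in> A. \<alpha> a \<in> S} = A" using assms(3) by auto
  then show ?thesis using sum_fibre_weight[OF assms(1,2), where Q = "\<lambda>_. True"] assms by simp
qed

text \<open>Maximise the product of coset masses divided by \<open>|H| powr (1 / 81)\<close> over
  the finitely many subspaces and pairs of translates, and let \<open>\<pi>\<close> have kernel
  \<open>H\<close>. Comparison with the trivial subspace bounds the kernel; comparison with the
  preimage \<open>G\<close> of \<open>V\<close> gives minimality.\<close>

lemma exists_minimal_quotient:
  fixes p q :: "(nat \<Rightarrow> bit) \<Rightarrow> real"
  assumes nonneg: "\<And>x. p x \<ge> 0" "\<And>x. q x \<ge> 0"
    and m0: "m0 \<in> coord_space n" "m0' \<in> coord_space n" "p m0 > 0" "q m0' > 0"
  obtains \<pi> :: "(nat \<Rightarrow> bit) \<Rightarrow> nat \<Rightarrow> bit" and m m' P Q where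
    "\<And>x y. \<pi> (x + y) = \<pi> x + \<pi> y" "\<pi> ` coord_space n \<subseteq> coord_space n"
    "m \<in> coord_space n" "m' \<in> coord_space n"
    "\<And>z. P z = (\<Sum>w\<in>{w \<in> coord_space n. \<pi> w = z}. p w)"
    "\<And>z. Q z = (\<Sum>w\<in>{w \<in> coord_space n. \<pi> w = z}. q w)"
    "P m > 0" "Q m' > 0"
    "real (card {x \<in> coord_space n. \<pi> x = 0}) powr (1 / 81) * (p m0 * q m0') \<le> P m * Q m'"
    "p m0 * q m0' \<le> P m * Q m'"
    "\<And>V x y. \<lbrakk>fun_vs.subspace V; V \<subseteq> coord_space n; x \<in> coord_space n; y \<in> coord_space n\<rbrakk>
      \<Longrightarrow> (\<Sum>v\<in>V. P (x + v)) * (\<Sum>v\<in>V. Q (y + v)) \<le> P m * Q m' * real (card V) powr (1 / 81)"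
proof -
  define T :: "((nat \<Rightarrow> bit) set \<times> (nat \<Rightarrow> bit) \<times> (nat \<Rightarrow> bit)) set"
    where "T = {H. fun_vs.subspace H \<and> H \<subseteq> coord_space n} \<times> coord_space n \<times> coord_space n"
  define mass where "mass = (\<lambda>(f :: (nat \<Rightarrow> bit) \<Rightarrow> real) H x. \<Sum>v\<in>H. f (x + v))"
  define F where "F = (\<lambda>(H :: (nat \<Rightarrow> bit) set, x, y). mass p H x * mass q H y / real (card H) powr (1 / 81))"
  have "finite {H :: (nat \<Rightarrow> bit) set. fun_vs.subspace H \<and> H \<subseteq> coord_space n}"
    by (rule finite_subset[of _ "Pow (coord_space n)"]) auto
  then have finT: "finite T" by (simp add: T_def)
  have T0: "({0}, m0, m0') \<in> T" using m0 by (auto simp: T_def subspace_bit_iff)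
  then have "T \<noteq> {}" by auto
  then have "\<exists>t\<in>T. \<forall>t'\<in>T. F t' \<le> F t"
  proof -
    have "Max (F ` T) \<in> F ` T" using finT \<open>T \<noteq> {}\<close> by (intro Max_in) auto
    then obtain t where t: "t \<in> T" "Max (F ` T) = F t" by auto
    have "F t' \<le> F t" if "t' \<in> T" for t' using Max_ge[of "F ` T" "F t'"] finT that t by simp
    with t show ?thesis by blast
  qed
  then obtain H x0 y0 where t: "(H, x0, y0) \<in> T" and max: "\<And>t'. t' \<in> T \<Longrightarrow> F t' \<le> F (H, x0, y0)"
    by auto
  have H: "fun_vs.subspace H" "H \<subseteq> coord_space n" and x0: "x0 \<in> coord_space n" "y0 \<in> coord_space n"
    using t by (auto simp: T_def)
  have finH: "finite H" using H by (auto intro: finite_subset[OF _ finite_coord_space_bit])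
  have cH: "card H \<ge> 1" using finH H by (auto simp: subspace_bit_iff card_gt_0_iff Suc_le_eq)
  obtain \<pi> :: "(nat \<Rightarrow> bit) \<Rightarrow> nat \<Rightarrow> bit" where
    \<pi>: "\<And>x y. \<pi> (x + y) = \<pi> x + \<pi> y" "\<pi> ` coord_space n \<subseteq> coord_space n" "\<And>x. \<pi> x = 0 \<longleftrightarrow> x \<in> H"
    using exists_additive_with_kernel[OF H] by (elim exE conjE) blast
  have \<pi>eq: "\<pi> x = \<pi> y \<longleftrightarrow> x + y \<in> H" for x y
    using \<pi>(1,3) by (metis bit_fun_add_eq_0_iff)
  define push where "push = (\<lambda>(f :: (nat \<Rightarrow> bit) \<Rightarrow> real) z. \<Sum>w\<in>{w \<in> coord_space n. \<pi> w = z}. f w)"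
  have coset: "{w \<in> coord_space n. w + w0 \<in> G} = (+) w0 ` G"
    if "G \<subseteq> coord_space n" "w0 \<in> coord_space n" for G and w0 :: "nat \<Rightarrow> bit"
  proof (intro equalityI subsetI)
    fix w assume "w \<in> {w \<in> coord_space n. w + w0 \<in> G}"
    then have "w + w0 \<in> G" "w = w0 + (w + w0)" by (auto simp: add.commute[of w w0])
    then show "w \<in> (+) w0 ` G" by blast
  qed (use that in \<open>auto simp: add.commute[of _ w0] intro!: coord_space_add\<close>)
  have sum_coset: "(\<Sum>w\<in>{w \<in> coord_space n. w + w0 \<in> G}. f w) = mass f G w0"
    if "G \<subseteq> coord_space n" "w0 \<in> coord_space n" for G w0 and f :: "(nat \<Rightarrow> bit) \<Rightarrow> real"
    unfolding coset[OF that] mass_def by (subst sum.reindex) auto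
  have push: "push f (\<pi> w0) = mass f H w0" if "w0 \<in> coord_space n" for f w0
    unfolding push_def \<pi>eq using sum_coset[OF H(2) that] .
  have mass0: "mass f H x \<ge> 0" if "\<And>x. f x \<ge> 0" for f H x
    unfolding mass_def using that by (intro sum_nonneg)
  have best: "real (card H) powr (1 / 81) * (p m0 * q m0') \<le> push p (\<pi> x0) * push q (\<pi> y0)"
    using max[OF T0] cH x0 by (simp add: F_def push) (simp add: mass_def field_simps)
  have one: "real (card H) powr (1 / 81) \<ge> 1" using cH by (intro ge_one_powr_ge_zero) auto
  have pq: "p m0 * q m0' > 0" using m0 by simp
  then have le: "p m0 * q m0' \<le> real (card H) powr (1 / 81) * (p m0 * q m0')"
    using mult_right_mono[OF one, of "p m0 * q m0'"] by simp
  have pp: "push p (\<pi> x0) * push q (\<pi> y0) > 0" using best le pq by linarith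
  moreover have "push p (\<pi> x0) \<ge> 0" "push q (\<pi> y0) \<ge> 0" using nonneg by (auto simp: push_def sum_nonneg)
  ultimately have pos: "push p (\<pi> x0) > 0" "push q (\<pi> y0) > 0"
    by (auto simp: zero_less_mult_iff)
  have "{x \<in> coord_space n. \<pi> x = 0} = H" using \<pi>(3) H by auto
  note ker = this
  have min: "(\<Sum>v\<in>V. push p (x + v)) * (\<Sum>v\<in>V. push q (y + v))
      \<le> push p (\<pi> x0) * push q (\<pi> y0) * real (card V) powr (1 / 81)"
    if V: "fun_vs.subspace V" "V \<subseteq> coord_space n" for V and x y :: "nat \<Rightarrow> bit"
  proof -
    define G where "G = {w \<in> coord_space n. \<pi> w \<in> V}"
    have finV: "finite V" using V by (auto intro: finite_subset[OF _ finite_coord_space_bit])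
    have \<pi>0: "\<pi> 0 = 0" using \<pi>(3) H by (auto simp: subspace_bit_iff)
    have G: "fun_vs.subspace G" "G \<subseteq> coord_space n"
      using V \<pi>0 by (auto simp: G_def subspace_bit_iff \<pi>(1) coord_space_add)
    have finG: "finite G" using G by (auto intro: finite_subset[OF _ finite_coord_space_bit])
    have cG0: "card G \<ge> 1" using finG G by (auto simp: subspace_bit_iff card_gt_0_iff Suc_le_eq)
    \<comment> \<open>The map \<open>\<pi>\<close> may fail to be surjective, so the part of the
      domain lying over \<open>x + V\<close> is either empty or a full coset of \<open>G\<close>;
      hence an inequality.\<close>
    have push_mass: "\<exists>w\<in>coord_space n. (\<Sum>v\<in>V. push f (x + v)) \<le> mass f G w"
      if f: "\<And>x. f x \<ge> 0" for f :: "(nat \<Rightarrow> bit) \<Rightarrow> real" and x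
    proof -
      define S where "S = {w \<in> coord_space n. \<pi> w + x \<in> V}"
      have "(\<Sum>v\<in>V. push f (x + v)) = (\<Sum>v\<in>V. \<Sum>w\<in>{w \<in> S. \<pi> w + x = v}. f w)"
        unfolding push_def S_def
        by (intro sum.cong refl arg_cong2[where f = sum]) (auto simp: ac_simps)
      also have "\<dots> = (\<Sum>w\<in>S. f w)"
        using finV by (intro sum.group) (auto simp: S_def)
      finally have eq: "(\<Sum>v\<in>V. push f (x + v)) = (\<Sum>w\<in>S. f w)" .
      show ?thesis
      proof (cases "S = {}")
        case True
        then show ?thesis using eq mass0[OF f] by (intro bexI[of _ 0]) auto
      next
        case False
        then obtain w0 where w0: "w0 \<in> coord_space n" "\<pi> w0 + x \<in> V" by (auto simp: S_def)
        have "\<pi> w + x \<in> V \<longleftrightarrow> \<pi> (w + w0) \<in> V" for w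
        proof -
          have "(\<pi> w + x) + (\<pi> w0 + x) = \<pi> (w + w0)" by (simp add: \<pi>(1) ac_simps)
          moreover have "(\<pi> w0 + x) + \<pi> (w + w0) = \<pi> w + x"
            by (simp add: \<pi>(1) add.left_commute add.commute)
          ultimately show ?thesis using w0 V by (metis subspace_bit_iff)
        qed
        then have "S = {w \<in> coord_space n. w + w0 \<in> G}"
          using w0 by (auto simp: S_def G_def coord_space_add)
        then show ?thesis using eq sum_coset[OF G(2) w0(1), of f] w0 by auto
      qed
    qed
    obtain w1 where w1: "w1 \<in> coord_space n" "(\<Sum>v\<in>V. push p (x + v)) \<le> mass p G w1"
      using push_mass[of p x, OF nonneg(1)] by blast
    obtain w2 where w2: "w2 \<in> coord_space n" "(\<Sum>v\<in>V. push q (y + v)) \<le> mass q G w2"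
      using push_mass[of q y, OF nonneg(2)] by blast
    have cG: "card G \<le> card H * card V"
    proof -
      have "G = (\<Union>v\<in>V. {w \<in> coord_space n. \<pi> w = v})" by (auto simp: G_def)
      then have "card G \<le> (\<Sum>v\<in>V. card {w \<in> coord_space n. \<pi> w = v})"
        using card_UN_le[OF finV] by metis
      also have "\<dots> \<le> (\<Sum>v\<in>V. card H)"
      proof (rule sum_mono)
        fix v
        show "card {w \<in> coord_space n. \<pi> w = v} \<le> card H"
        proof (cases "{w \<in> coord_space n. \<pi> w = v} = {}")
          case True
          show ?thesis unfolding True by simp
        next
          case False
          then obtain w0 where w0: "w0 \<in> coord_space n" "v = \<pi> w0" by auto
          show ?thesis unfolding w0 \<pi>eq coset[OF H(2) w0(1)] by (rule card_image_le[OF finH])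
        qed
      qed
      finally show ?thesis by (simp add: mult.commute)
    qed
    have "(\<Sum>v\<in>V. push p (x + v)) * (\<Sum>v\<in>V. push q (y + v)) \<le> mass p G w1 * mass q G w2"
      using w1 w2 nonneg mass0 by (intro mult_mono) (auto simp: push_def intro!: sum_nonneg)
    also have "\<dots> = F (G, w1, w2) * real (card G) powr (1 / 81)" using cG0 by (simp add: F_def)
    also have "\<dots> \<le> F (H, x0, y0) * real (card G) powr (1 / 81)"
      using G w1 w2 by (intro mult_right_mono max) (auto simp: T_def)
    also have "\<dots> \<le> F (H, x0, y0) * (real (card H) * real (card V)) powr (1 / 81)"
    proof (intro mult_left_mono powr_mono2)
      show "0 \<le> F (H, x0, y0)" using mass0 nonneg by (simp add: F_def)
    qed (use cG of_nat_le_iff[of "card G" "card H * card V"] in auto)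
    also have "\<dots> = mass p H x0 * mass q H y0 * real (card V) powr (1 / 81)"
      using cH by (simp add: F_def powr_mult)
    finally show ?thesis using x0 by (simp add: push)
  qed
  show thesis
  proof (rule that[of \<pi> "\<pi> x0" "\<pi> y0" "push p" "push q"])
    show "real (card {x \<in> coord_space n. \<pi> x = 0}) powr (1 / 81) * (p m0 * q m0')
      \<le> push p (\<pi> x0) * push q (\<pi> y0)" unfolding ker by (rule best)
    show "p m0 * q m0' \<le> push p (\<pi> x0) * push q (\<pi> y0)" using best le by linarith
  qed (use \<pi> x0 pos min in \<open>auto simp: push_def\<close>)
qed

text \<open>With \<open>u\<close>, \<open>w\<close> the densities of the two fibres, the exponent
  \<open>1 / 2 + 1 / R\<close> means that \<open>|A + B| / sqrt (|A| |B|)\<close> shrinks by at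
  least the factor \<open>(u * w) powr (1 / R)\<close>. The fibres may be all of \<open>A\<close>
  and \<open>B\<close>; the bound on the kernel is then the useful information.\<close>

definition fibre_split ::
  "'a::plus set \<Rightarrow> 'a set \<Rightarrow> ('a \<Rightarrow> nat \<Rightarrow> bit) \<Rightarrow> ('a \<Rightarrow> nat \<Rightarrow> bit) \<Rightarrow> nat \<Rightarrow> real \<Rightarrow> real \<Rightarrow> bool"
where
  "fibre_split A B \<alpha> \<beta> n N R \<longleftrightarrow>
    (\<exists>\<pi> :: (nat \<Rightarrow> bit) \<Rightarrow> nat \<Rightarrow> bit. (\<forall>x y. \<pi> (x + y) = \<pi> x + \<pi> y) \<and>
      real (card {x \<in> coord_space n. \<pi> x = 0}) \<le> N \<and>
      (\<exists>x y. let A' = {a \<in> A. \<pi> (\<alpha> a) = x}; B' = {b \<in> B. \<pi> (\<beta> b) = y} in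
        A' \<noteq> {} \<and> B' \<noteq> {} \<and> real (card (A' + B')) \<le> real (card (A + B)) *
          ((real (card A') / real (card A)) * (real (card B') / real (card B))) powr (1 / 2 + 1 / R)))"

text \<open>Pass to the optimal quotient. If all pairs of fibres were uneconomical, the fibre
  distributions on \<open>A\<close>, \<open>B\<close> and \<open>A + B\<close> would form a sparse
  pair, because \<open>A' + B'\<close> lies in one fibre of the sumset. Three maps are used since
  \<open>A\<close> and \<open>B\<close> may sit in different cosets.\<close>

lemma exists_economical_fibres:
  assumes adm: "admissible_PFR C\<^sub>P c"
  obtains C0 :: real where "C0 \<ge> 4"
    "\<And>(A :: 'a::ab_group_add set) B \<alpha> \<beta> \<gamma> n m0 m0' h R. \<lbrakk>finite A; finite B; A \<noteq> {}; B \<noteq> {};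
       \<alpha> ` A \<subseteq> coord_space n; \<beta> ` B \<subseteq> coord_space n;
       \<forall>a\<in>A. \<forall>b\<in>B. \<gamma> (a + b) = \<alpha> a + \<beta> b;
       m0 \<in> coord_space n; m0' \<in> coord_space n;
       exp (- h) \<le> fibre_weight A \<alpha> m0 * fibre_weight B \<beta> m0';
       R \<ge> C0; R \<ge> C0 * h powr (1 - 1 / C\<^sub>P)\<rbrakk> \<Longrightarrow>
       fibre_split A B \<alpha> \<beta> n (exp (81 * h)) R"
proof -
  have CP: "C\<^sub>P \<ge> 1" by (rule admissible_exponent_ge_1[OF adm])
  obtain C0 :: real where C0: "C0 \<ge> 4"
    "\<And>n p q W m m' R. \<lbrakk>sparse_pair n p q W m m' R; R \<ge> C0;
       R \<ge> C0 * ln (1 / (p m * q m')) powr (1 - 1 / C\<^sub>P)\<rbrakk> \<Longrightarrow> False"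
    using sparse_pair_impossible[OF adm] by blast
  show thesis
  proof (rule that[OF C0(1)])
    fix A B :: "'a set" and \<alpha> \<beta> \<gamma> :: "'a \<Rightarrow> nat \<Rightarrow> bit" and n and m0 m0' :: "nat \<Rightarrow> bit" and h R :: real
    assume fin: "finite A" "finite B" and ne: "A \<noteq> {}" "B \<noteq> {}"
      and im: "\<alpha> ` A \<subseteq> coord_space n" "\<beta> ` B \<subseteq> coord_space n"
      and \<gamma>: "\<forall>a\<in>A. \<forall>b\<in>B. \<gamma> (a + b) = \<alpha> a + \<beta> b"
      and m0: "m0 \<in> coord_space n" "m0' \<in> coord_space n"
      and h: "exp (- h) \<le> fibre_weight A \<alpha> m0 * fibre_weight B \<beta> m0'"
      and R: "R \<ge> C0" "R \<ge> C0 * h powr (1 - 1 / C\<^sub>P)"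
    have "0 < exp (- h)" by simp
    then have "fibre_weight A \<alpha> m0 * fibre_weight B \<beta> m0' > 0" using h by linarith
    then have fw: "fibre_weight A \<alpha> m0 > 0" "fibre_weight B \<beta> m0' > 0"
      using fibre_weight_nonneg[of A \<alpha> m0] fibre_weight_nonneg[of B \<beta> m0']
      by (auto simp: zero_less_mult_iff)
    obtain \<pi> :: "(nat \<Rightarrow> bit) \<Rightarrow> nat \<Rightarrow> bit" and m m' P Q where
      \<pi>: "\<And>x y. \<pi> (x + y) = \<pi> x + \<pi> y" "\<pi> ` coord_space n \<subseteq> coord_space n"
      and mm: "m \<in> coord_space n" "m' \<in> coord_space n"
      and P: "\<And>z. P z = (\<Sum>w\<in>{w \<in> coord_space n. \<pi> w = z}. fibre_weight A \<alpha> w)"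
      and Q: "\<And>z. Q z = (\<Sum>w\<in>{w \<in> coord_space n. \<pi> w = z}. fibre_weight B \<beta> w)"
      and pos: "P m > 0" "Q m' > 0"
      and ker: "real (card {x \<in> coord_space n. \<pi> x = 0}) powr (1 / 81) *
        (fibre_weight A \<alpha> m0 * fibre_weight B \<beta> m0') \<le> P m * Q m'"
      and mode: "fibre_weight A \<alpha> m0 * fibre_weight B \<beta> m0' \<le> P m * Q m'"
      and minimal: "\<And>V x y. \<lbrakk>fun_vs.subspace V; V \<subseteq> coord_space n; x \<in> coord_space n; y \<in> coord_space n\<rbrakk>
        \<Longrightarrow> (\<Sum>v\<in>V. P (x + v)) * (\<Sum>v\<in>V. Q (y + v)) \<le> P m * Q m' * real (card V) powr (1 / 81)"
      using exists_minimal_quotient[where p = "fibre_weight A \<alpha>" and q = "fibre_weight B \<beta>",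
          OF fibre_weight_nonneg fibre_weight_nonneg m0 fw] by blast
    have P': "P = fibre_weight A (\<pi> \<circ> \<alpha>)" and Q': "Q = fibre_weight B (\<pi> \<circ> \<beta>)"
      by (rule ext, simp only: P Q fibre_weight_comp[OF fin(1) finite_coord_space_bit im(1)]
          fibre_weight_comp[OF fin(2) finite_coord_space_bit im(2)])+
    have im': "(\<pi> \<circ> \<alpha>) ` A \<subseteq> coord_space n" "(\<pi> \<circ> \<beta>) ` B \<subseteq> coord_space n"
      using im \<pi>(2) by (auto simp: image_subset_iff)
    have finAB: "finite (A + B)" using fin by (rule finite_set_plus)
    have AB: "A + B \<noteq> {}" using ne by (auto simp: set_plus_def)
    have imAB: "(\<pi> \<circ> \<gamma>) ` (A + B) \<subseteq> coord_space n"
      using im' by (auto elim!: set_plus_elim simp: \<gamma> \<pi>(1) image_subset_iff intro!: coord_space_add)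
    have tot: "(\<Sum>x\<in>coord_space n. P x) = 1" "(\<Sum>x\<in>coord_space n. Q x) = 1"
      unfolding P' Q' using fin ne im' by (auto intro!: fibre_weight_total)
    have le1: "P m \<le> 1" "Q m' \<le> 1"
      using member_le_sum[of m "coord_space n" P] member_le_sum[of m' "coord_space n" Q] mm tot
      by (auto simp: P' Q')
    have PQ1: "P m * Q m' \<le> 1" using le1 pos by (simp add: mult_le_one)
    have PQ: "P m * Q m' \<ge> exp (- h)" using mode h by linarith
    have PQ0: "P m * Q m' > 0" using pos by simp
    show "fibre_split A B \<alpha> \<beta> n (exp (81 * h)) R"
      unfolding fibre_split_def
    proof (intro exI[of _ \<pi>] conjI allI)
      show "\<pi> (x + y) = \<pi> x + \<pi> y" for x y by (rule \<pi>)
      \<comment> \<open>The product of the largest densities is at most \<open>1\<close>, while the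
        optimal quotient makes it at least \<open>k powr (1 / 81) * exp (- h)\<close>; so the
        exponent \<open>1 / 81\<close> becomes the factor \<open>81\<close>.\<close>
      define k where "k = real (card {x \<in> coord_space n. \<pi> x = 0})"
      have "k powr (1 / 81) * exp (- h) \<le> k powr (1 / 81) * (fibre_weight A \<alpha> m0 * fibre_weight B \<beta> m0')"
        using h by (intro mult_left_mono) auto
      also have "\<dots> \<le> 1" using ker PQ1 by (simp add: k_def)
      finally have "k powr (1 / 81) \<le> exp h" by (simp add: exp_minus field_simps)
      then have "(k powr (1 / 81)) powr 81 \<le> exp h powr 81" by (intro powr_mono2) auto
      then have "k \<le> exp (81 * h)" by (simp add: powr_powr k_def exp_powr_real mult.commute)
      then show "real (card {x \<in> coord_space n. \<pi> x = 0}) \<le> exp (81 * h)" by (simp add: k_def)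
    next
      show "\<exists>x y. let A' = {a \<in> A. \<pi> (\<alpha> a) = x}; B' = {b \<in> B. \<pi> (\<beta> b) = y} in
           A' \<noteq> {} \<and> B' \<noteq> {} \<and> real (card (A' + B')) \<le> real (card (A + B)) *
             ((real (card A') / real (card A)) * (real (card B') / real (card B))) powr (1 / 2 + 1 / R)"
      proof (rule ccontr)
        assume contra: "\<not> ?thesis"
        define W where "W = fibre_weight (A + B) (\<pi> \<circ> \<gamma>)"
        have "sparse_pair n P Q W m m' R"
        proof
          show "sum W (coord_space n) \<le> 1"
            unfolding W_def using fibre_weight_total[OF finAB _ imAB AB] by simp
          show "4 \<le> R" using C0 R by linarith
          fix x y :: "nat \<Rightarrow> bit"
          assume "P x > 0" "Q y > 0"
          define A' B' where "A' = {a \<in> A. \<pi> (\<alpha> a) = x}" and "B' = {b \<in> B. \<pi> (\<beta> b) = y}"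
          have "card A' > 0" "card B' > 0" using \<open>P x > 0\<close> \<open>Q y > 0\<close>
            by (auto simp: P' Q' fibre_weight_def A'_def B'_def zero_less_divide_iff)
          then have "A' \<noteq> {}" "B' \<noteq> {}" by auto
          then have lt: "real (card (A' + B')) > real (card (A + B)) *
             ((real (card A') / real (card A)) * (real (card B') / real (card B))) powr (1 / 2 + 1 / R)"
            using contra unfolding A'_def B'_def Let_def by (meson not_le)
          have "A' + B' \<subseteq> {d \<in> A + B. (\<pi> \<circ> \<gamma>) d = x + y}"
            by (auto elim!: set_plus_elim simp: A'_def B'_def \<gamma> \<pi>(1))
          then have "card (A' + B') \<le> card {d \<in> A + B. (\<pi> \<circ> \<gamma>) d = x + y}"
            using finAB by (intro card_mono) auto
          then have "real (card (A' + B')) \<le> real (card (A + B)) * W (x + y)"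
            using finAB AB by (simp add: W_def fibre_weight_def)
          moreover have "P x * Q y = (real (card A') / real (card A)) * (real (card B') / real (card B))"
            by (simp add: P' Q' fibre_weight_def A'_def B'_def)
          ultimately have "real (card (A + B)) * (P x * Q y) powr (1 / 2 + 1 / R) < real (card (A + B)) * W (x + y)"
            using lt by simp
          then show "(P x * Q y) powr (1 / 2 + 1 / R) < W (x + y)"
            by (simp add: mult_less_cancel_left)
        qed (use tot mm pos minimal in \<open>auto simp: P' Q' W_def\<close>)
        \<comment> \<open>Passing to the optimal quotient only increased the product of the modes,
          so its min-entropy is still at most \<open>h\<close>.\<close>
        moreover have "C0 * ln (1 / (P m * Q m')) powr (1 - 1 / C\<^sub>P) \<le> R"
        proof -
          have "ln (exp (- h)) \<le> ln (P m * Q m')" using PQ PQ0 by (subst ln_le_cancel_iff) auto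
          then have "ln (1 / (P m * Q m')) \<le> h" using pos by (simp add: ln_div)
          moreover have "ln (1 / (P m * Q m')) \<ge> 0" using PQ1 PQ0 by (intro ln_ge_zero) simp
          ultimately have "ln (1 / (P m * Q m')) powr (1 - 1 / C\<^sub>P) \<le> h powr (1 - 1 / C\<^sub>P)"
            using CP by (intro powr_mono2) auto
          then have "C0 * ln (1 / (P m * Q m')) powr (1 - 1 / C\<^sub>P) \<le> C0 * h powr (1 - 1 / C\<^sub>P)"
            using C0(1) by (intro mult_left_mono) auto
          then show ?thesis using R by linarith
        qed
        ultimately show False using C0(2) R(1) by blast
      qed
    qed
  qed
qed

section \<open>Reduction of a lattice modulo two, and a popular class of a set with small
  sumset\<close>

section \<open>Integer lattices\<close>

lemma coord_space_diff: "x \<in> coord_space n \<Longrightarrow> y \<in> coord_space n \<Longrightarrow> x - y \<in> coord_space n"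
  for x y :: "nat \<Rightarrow> 'a::group_add"
  by (simp add: coord_space_def)

lemma coord_space_SucD: "x \<in> coord_space (Suc d) \<Longrightarrow> x d = 0 \<Longrightarrow> x \<in> coord_space d"
  unfolding coord_space_def by simp (metis Suc_leI le_neq_implies_less)

text \<open>\<open>g\<close> is reduction modulo two in the coordinates of a basis of \<open>\<Lambda>\<close>.\<close>
lemma lattice_mod_2:
  fixes \<Lambda> :: "(nat \<Rightarrow> int) set"
  assumes "\<Lambda> \<subseteq> coord_space d" "0 \<in> \<Lambda>" "\<And>x y. x \<in> \<Lambda> \<Longrightarrow> y \<in> \<Lambda> \<Longrightarrow> x - y \<in> \<Lambda>"
  shows "\<exists>e (g :: (nat \<Rightarrow> int) \<Rightarrow> nat \<Rightarrow> bit) U. (\<forall>x\<in>\<Lambda>. \<forall>y\<in>\<Lambda>. g (x + y) = g x + g y) \<and>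
    g ` \<Lambda> = coord_space e \<and> finite U \<and> card U \<le> e \<and>
    (\<forall>x\<in>\<Lambda>. (\<lambda>i. real_of_int (x i)) \<in> fun_vs.span U)"
  using assms
proof (induction d arbitrary: \<Lambda>)
  case 0
  have "coord_space 0 = {0 :: nat \<Rightarrow> int}" by (auto simp: coord_space_def fun_eq_iff)
  then have "\<Lambda> = {0}" using 0(1,2) by auto
  have bit0: "coord_space 0 = {0 :: nat \<Rightarrow> bit}" by (auto simp: coord_space_def fun_eq_iff)
  have "(\<lambda>i. real_of_int ((0 :: nat \<Rightarrow> int) i)) = 0" by (rule ext) simp
  then have "(\<lambda>i. real_of_int ((0 :: nat \<Rightarrow> int) i)) \<in> fun_vs.span {}"
    by (simp only: fun_vs.span_zero)
  then have "(\<forall>x\<in>{0 :: nat \<Rightarrow> int}. \<forall>y\<in>{0 :: nat \<Rightarrow> int}. (0 :: nat \<Rightarrow> bit) = 0 + 0) \<and>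
      (\<lambda>_. 0) ` {0 :: nat \<Rightarrow> int} = (coord_space 0 :: (nat \<Rightarrow> bit) set) \<and>
      finite {} \<and> card ({} :: (nat \<Rightarrow> real) set) \<le> 0 \<and>
      (\<forall>x\<in>{0}. (\<lambda>i. real_of_int (x i)) \<in> fun_vs.span {})"
    unfolding bit0 by (intro conjI ballI) (simp_all only: singleton_iff add_0_left image_constant_conv
      insert_not_empty if_False finite.emptyI card.empty order_refl)
  then show ?case unfolding \<open>\<Lambda> = {0}\<close>
    by (intro exI[of _ "0 :: nat"] exI[of _ "\<lambda>_. 0"] exI[of _ "{}"])
next
  case (Suc d)
  show ?case
  proof (cases "\<forall>v\<in>\<Lambda>. v d = 0")
    case True
    then have "\<Lambda> \<subseteq> coord_space d" using Suc.prems(1) coord_space_SucD by blast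
    then show ?thesis by (rule Suc.IH) (rule Suc.prems(2,3); assumption)+
  next
    case False
    have neg: "- x \<in> \<Lambda>" if "x \<in> \<Lambda>" for x
      using Suc.prems(3)[OF Suc.prems(2) that] by (simp only: diff_0)
    have add: "x + y \<in> \<Lambda>" if "x \<in> \<Lambda>" "y \<in> \<Lambda>" for x y
      using Suc.prems(3)[OF that(1) neg[OF that(2)]] by (simp only: diff_minus_eq_add)
    \<comment> \<open>The least positive last coordinate \<open>m\<close>, attained by
      \<open>w\<close>, divides all last coordinates by Euclidean division. Thus each
      \<open>x\<close> is uniquely \<open>r x\<close> plus \<open>q x\<close> copies of
      \<open>w\<close>, with \<open>r x\<close> in the sublattice covered by the induction.\<close>
    define Pr where "Pr = (\<lambda>m::nat. m > 0 \<and> (\<exists>w\<in>\<Lambda>. w d = int m))"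
    from False obtain v where v: "v \<in> \<Lambda>" "v d \<noteq> 0" by auto
    have "Pr (nat \<bar>v d\<bar>)"
    proof (cases "v d > 0")
      case True
      then show ?thesis using v unfolding Pr_def by (intro conjI bexI[of _ v]) auto
    next
      case False
      then show ?thesis using v neg[OF v(1)] unfolding Pr_def by (intro conjI bexI[of _ "- v"]) auto
    qed
    define m where "m = (LEAST m. Pr m)"
    have "Pr m" unfolding m_def by (rule LeastI) fact
    then obtain w where w: "m > 0" "w \<in> \<Lambda>" "w d = int m" by (auto simp: Pr_def)
    have least: "\<not> Pr j" if "j < m" for j using not_less_Least that by (auto simp: m_def)
    define kw where "kw = (\<lambda>k::int. \<lambda>i. k * w i)"
    have kwn: "kw (int j) \<in> \<Lambda>" for j
    proof (induction j)
      case 0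
      have "kw (int 0) = 0" by (simp add: kw_def fun_eq_iff)
      then show ?case using Suc.prems by simp
    next
      case (Suc j)
      have "kw (int (Suc j)) = kw (int j) + w" by (simp add: kw_def fun_eq_iff algebra_simps)
      then show ?case using add[OF Suc w(2)] by (simp only:)
    qed
    have kw: "kw k \<in> \<Lambda>" for k
    proof (cases "k \<ge> 0")
      case True
      then show ?thesis using kwn[of "nat k"] by simp
    next
      case False
      then have "kw k = - kw (int (nat (- k)))" by (simp add: kw_def fun_eq_iff)
      then show ?thesis using neg[OF kwn] by (simp only:)
    qed
    define q where "q = (\<lambda>x :: nat \<Rightarrow> int. x d div int m)"
    define r where "r = (\<lambda>x. x - kw (q x))"
    have r\<Lambda>: "r x \<in> \<Lambda>" if "x \<in> \<Lambda>" for x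
      unfolding r_def by (rule Suc.prems(3)[OF that kw])
    have rd: "r x d = 0" if x: "x \<in> \<Lambda>" for x
    proof (rule ccontr)
      assume ne: "r x d \<noteq> 0"
      have rm: "r x d = x d mod int m"
        by (simp add: r_def kw_def q_def w(3) minus_div_mult_eq_mod)
      then have b: "0 \<le> r x d" "r x d < int m" using w(1) by auto
      then have "Pr (nat (r x d))" using ne r\<Lambda>[OF x] by (auto simp: Pr_def)
      moreover have "nat (r x d) < m" using b by linarith
      ultimately show False using least by blast
    qed
    have xd: "x d = q x * int m" if "x \<in> \<Lambda>" for x
    proof -
      have "r x d = x d - q x * int m" by (simp add: r_def kw_def w(3))
      then show ?thesis using rd[OF that] by linarith
    qed
    have q_add: "q (x + y) = q x + q y" if "x \<in> \<Lambda>" "y \<in> \<Lambda>" for x y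
    proof -
      have "q (x + y) * int m = (x + y) d" using xd[OF add[OF that]] by (rule sym)
      also have "\<dots> = q x * int m + q y * int m"
        using xd[OF that(1)] xd[OF that(2)] by (simp only: plus_fun_apply)
      finally have "q (x + y) * int m = (q x + q y) * int m" by (simp only: distrib_right)
      then show ?thesis using w(1) by simp
    qed
    have r_add: "r (x + y) = r x + r y" if "x \<in> \<Lambda>" "y \<in> \<Lambda>" for x y
      unfolding r_def kw_def q_add[OF that] by (rule ext) (simp add: algebra_simps)
    define \<Lambda>' where "\<Lambda>' = {v \<in> \<Lambda>. v d = 0}"
    have L1: "\<Lambda>' \<subseteq> coord_space d" using Suc.prems(1) coord_space_SucD unfolding \<Lambda>'_def by blast
    have L2: "0 \<in> \<Lambda>'"
      unfolding \<Lambda>'_def by (intro CollectI conjI) (rule Suc.prems(2), simp)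
    have L3: "x - y \<in> \<Lambda>'" if "x \<in> \<Lambda>'" "y \<in> \<Lambda>'" for x y
    proof -
      have "x - y \<in> \<Lambda>" using that by (intro Suc.prems(3)) (simp_all only: \<Lambda>'_def mem_Collect_eq)
      then show ?thesis unfolding \<Lambda>'_def by (intro CollectI conjI) (use that \<Lambda>'_def in simp_all)
    qed
    have "\<exists>e (g :: (nat \<Rightarrow> int) \<Rightarrow> nat \<Rightarrow> bit) U. (\<forall>x\<in>\<Lambda>'. \<forall>y\<in>\<Lambda>'. g (x + y) = g x + g y) \<and>
        g ` \<Lambda>' = coord_space e \<and> finite U \<and> card U \<le> e \<and>
        (\<forall>x\<in>\<Lambda>'. (\<lambda>i. real_of_int (x i)) \<in> fun_vs.span U)"
      by (rule Suc.IH[OF L1 L2 L3])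
    then obtain e U and g :: "(nat \<Rightarrow> int) \<Rightarrow> nat \<Rightarrow> bit" where
      g: "\<forall>x\<in>\<Lambda>'. \<forall>y\<in>\<Lambda>'. g (x + y) = g x + g y" and im: "g ` \<Lambda>' = coord_space e"
      and U: "finite U" "card U \<le> e" "\<forall>x\<in>\<Lambda>'. (\<lambda>i. real_of_int (x i)) \<in> fun_vs.span U"
      by (elim exE conjE) (rule that)
    have r\<Lambda>': "r x \<in> \<Lambda>'" if "x \<in> \<Lambda>" for x using r\<Lambda> rd that by (auto simp: \<Lambda>'_def)
    have gr: "g (r x) \<in> coord_space e" if "x \<in> \<Lambda>" for x using r\<Lambda>'[OF that] im by blast
    \<comment> \<open>The parity of the coefficient of the new basis vector \<open>w\<close> is
      stored in the fresh coordinate \<open>e\<close>.\<close>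
    define g' where "g' = (\<lambda>x. (g (r x))(e := of_int (q x)))"
    define wr where "wr = (\<lambda>i. real_of_int (w i))"
    have g'_add: "g' (x + y) = g' x + g' y" if "x \<in> \<Lambda>" "y \<in> \<Lambda>" for x y
    proof -
      have "g (r (x + y)) = g (r x) + g (r y)"
        unfolding r_add[OF that] using g r\<Lambda>'[OF that(1)] r\<Lambda>'[OF that(2)] by blast
      then show ?thesis by (simp add: g'_def q_add[OF that] fun_eq_iff)
    qed
    moreover have "g' ` \<Lambda> = coord_space (Suc e)"
    proof (intro equalityI subsetI)
      fix z assume "z \<in> g' ` \<Lambda>"
      then show "z \<in> coord_space (Suc e)" using gr by (auto simp: g'_def coord_space_def)
    next
      fix z :: "nat \<Rightarrow> bit" assume z: "z \<in> coord_space (Suc e)"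
      have "z(e := 0) \<in> coord_space (Suc e)" using z by (auto simp: coord_space_def)
      then have "z(e := 0) \<in> coord_space e" by (rule coord_space_SucD) simp
      then have "z(e := 0) \<in> g ` \<Lambda>'" unfolding im .
      then obtain y where y: "y \<in> \<Lambda>'" "g y = z(e := 0)" by auto
      then have yd: "y d = 0" "y \<in> \<Lambda>" by (auto simp: \<Lambda>'_def)
      show "z \<in> g' ` \<Lambda>"
      proof (cases "z e = 0")
        case True
        have "q y = 0" using yd by (simp add: q_def)
        then have ry: "r y = y" by (simp add: r_def kw_def fun_eq_iff)
        have "g' y = z" unfolding g'_def ry y(2) \<open>q y = 0\<close> by (rule ext) (simp add: True)
        then show ?thesis using yd(2) by (rule image_eqI[OF sym])
      next
        case False
        have q1: "q (y + w) = 1" using yd w by (simp add: q_def)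
        then have r1: "r (y + w) = y" by (simp add: r_def kw_def fun_eq_iff)
        have "g' (y + w) = z" unfolding g'_def r1 y(2) q1 using False by (intro ext) simp
        then show ?thesis using add[OF yd(2) w(2)] by (rule image_eqI[OF sym])
      qed
    qed
    moreover have "(\<lambda>i. real_of_int (x i)) \<in> fun_vs.span (insert wr U)" if x: "x \<in> \<Lambda>" for x
    proof -
      have "(\<lambda>i. real_of_int (x i)) = (\<lambda>i. real_of_int (r x i)) + fun_scale (real_of_int (q x)) wr"
        by (simp add: r_def kw_def fun_eq_iff fun_scale_def wr_def)
      moreover have "(\<lambda>i. real_of_int (r x i)) \<in> fun_vs.span (insert wr U)"
        using U(3)[rule_format, OF r\<Lambda>'[OF x]] fun_vs.span_mono[of U "insert wr U", OF subset_insertI]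
        by (rule subsetD[rotated])
      moreover have "fun_scale (real_of_int (q x)) wr \<in> fun_vs.span (insert wr U)"
        by (intro fun_vs.span_scale fun_vs.span_base) simp
      ultimately show ?thesis by (simp add: fun_vs.span_add)
    qed
    moreover have "finite (insert wr U)" "card (insert wr U) \<le> Suc e"
      using U by (simp_all add: card_insert_if)
    ultimately have "(\<forall>x\<in>\<Lambda>. \<forall>y\<in>\<Lambda>. g' (x + y) = g' x + g' y) \<and> g' ` \<Lambda> = coord_space (Suc e) \<and>
        finite (insert wr U) \<and> card (insert wr U) \<le> Suc e \<and>
        (\<forall>x\<in>\<Lambda>. (\<lambda>i. real_of_int (x i)) \<in> fun_vs.span (insert wr U))"
      by (intro conjI ballI)
    then show ?thesis by (rule exI[where x = "Suc e", OF exI[where x = g', OF exI[where x = "insert wr U"]]])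
  qed
qed

lemma affine_dim_le_card:
  assumes "finite U" "\<And>a b. a \<in> A \<Longrightarrow> b \<in> A \<Longrightarrow> (\<lambda>i. real_of_int ((a - b) i)) \<in> fun_vs.span U"
  shows "affine_dim A \<le> card U"
  unfolding affine_dim_def using assms by (intro fun_vs.dim_le_card) auto

text \<open>For \<open>X \<subseteq> A\<close> from Petridis' argument, \<open>x + 2b\<close> determines the class of \<open>x\<close> modulo \<open>2\<Lambda>\<close>, so
  that \<open>X\<close> meets at most \<open>|X + B + B| / |B|\<close> classes.\<close>
lemma popular_fibre_mod_2:
  fixes A B :: "(nat \<Rightarrow> int) set" and g :: "(nat \<Rightarrow> int) \<Rightarrow> nat \<Rightarrow> bit"
  assumes fin: "finite A" "finite B" and ne: "A \<noteq> {}" "B \<noteq> {}"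
    and small: "real (card (A + B)) \<le> exp k * sqrt (real (card A) * real (card B))"
    and \<Lambda>: "\<And>x y. x \<in> \<Lambda> \<Longrightarrow> y \<in> \<Lambda> \<Longrightarrow> x - y \<in> \<Lambda>" "\<And>x y. x \<in> \<Lambda> \<Longrightarrow> y \<in> \<Lambda> \<Longrightarrow> x + y \<in> \<Lambda>"
    and g: "\<And>x y. x \<in> \<Lambda> \<Longrightarrow> y \<in> \<Lambda> \<Longrightarrow> g (x + y) = g x + g y"
    and A: "\<And>a. a \<in> A \<Longrightarrow> a - a0 \<in> \<Lambda>" and B: "\<And>b. b \<in> B \<Longrightarrow> b - b0 \<in> \<Lambda>"
  shows "\<exists>a\<in>A. exp (- 2 * k) \<le> fibre_weight A (\<lambda>a. g (a - a0)) (g (a - a0))"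
proof -
  define \<alpha> where "\<alpha> = (\<lambda>a. g (a - a0))"
  obtain X where X: "X \<subseteq> A" "X \<noteq> {}"
    "real (card (X + B + B)) \<le> (real (card (A + B)) / real (card A))\<^sup>2 * real (card X)"
    using petridis_iterated_sumset[OF fin ne] .
  have finX: "finite X" using X fin finite_subset by auto
  have "\<forall>z\<in>\<alpha> ` X. \<exists>x. x \<in> X \<and> \<alpha> x = z" by auto
  then obtain rep where rep: "\<And>z. z \<in> \<alpha> ` X \<Longrightarrow> rep z \<in> X \<and> \<alpha> (rep z) = z" by metis
  have "inj_on (\<lambda>(z, b). rep z + b + b) (\<alpha> ` X \<times> B)"
  proof (rule inj_onI, clarify)
    fix x b y b'
    assume a: "x \<in> X" "b \<in> B" "y \<in> X" "b' \<in> B" and eq: "rep (\<alpha> x) + b + b = rep (\<alpha> y) + b' + b'"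
    \<comment> \<open>The two representatives differ by \<open>\<delta> + \<delta>\<close>, which
      \<open>g\<close> kills. They are therefore in the same class, hence equal, and
      \<open>b + b = b' + b'\<close> remains.\<close>
    define \<delta> where "\<delta> = (b' - b0) - (b - b0)"
    have \<delta>: "\<delta> \<in> \<Lambda>" unfolding \<delta>_def by (rule \<Lambda>(1)[OF B[OF a(4)] B[OF a(2)]])
    have rx: "rep (\<alpha> x) \<in> X" "\<alpha> (rep (\<alpha> x)) = \<alpha> x" and ry: "rep (\<alpha> y) \<in> X" "\<alpha> (rep (\<alpha> y)) = \<alpha> y"
      using rep a by auto
    have "rep (\<alpha> x) - a0 = (rep (\<alpha> y) - a0) + (\<delta> + \<delta>)"
      using eq by (simp add: \<delta>_def algebra_simps)
    then have "g (rep (\<alpha> x) - a0) = g (rep (\<alpha> y) - a0) + (g \<delta> + g \<delta>)"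
      using g \<delta> \<Lambda> A ry X by (metis subsetD)
    then have xy: "\<alpha> x = \<alpha> y" using rx ry by (simp add: \<alpha>_def)
    then have "b + b = b' + b'" using eq by (simp add: add.assoc)
    then have "b i + b i = b' i + b' i" for i by (metis plus_fun_apply)
    then have "b i = b' i" for i by (smt (verit))
    then have "b = b'" by auto
    with xy show "\<alpha> x = \<alpha> y \<and> b = b'" by simp
  qed
  moreover have "(\<lambda>(z, b). rep z + b + b) ` (\<alpha> ` X \<times> B) \<subseteq> X + B + B"
  proof clarify
    fix x b assume "x \<in> X" "b \<in> B"
    then show "rep (\<alpha> x) + b + b \<in> X + B + B" using rep by (intro set_plus_intro) auto
  qed
  moreover have "finite (X + B + B)" using finX fin by (intro finite_set_plus)
  ultimately have "card (\<alpha> ` X \<times> B) \<le> card (X + B + B)" by (rule card_inj_on_le)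
  then have "real (card (\<alpha> ` X)) * real (card B) \<le> real (card (X + B + B))"
    unfolding card_cartesian_product by (metis of_nat_le_iff of_nat_mult)
  also have "\<dots> \<le> (real (card (A + B)) / real (card A))\<^sup>2 * real (card X)" by (rule X)
  also have "\<dots> \<le> (exp k * sqrt (real (card A) * real (card B)) / real (card A))\<^sup>2 * real (card X)"
    using small by (intro mult_right_mono power_mono divide_right_mono) auto
  also have "(exp k * sqrt (real (card A) * real (card B)) / real (card A))\<^sup>2
      = exp (2 * k) / real (card A) * real (card B)"
    using fin ne by (simp add: power_mult_distrib power_divide exp_double) (simp add: power2_eq_square field_simps)
  finally have "real (card (\<alpha> ` X)) * real (card B)
      \<le> (exp (2 * k) / real (card A) * real (card X)) * real (card B)" by (simp add: ac_simps)
  then have N: "real (card (\<alpha> ` X)) \<le> exp (2 * k) / real (card A) * real (card X)"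
    by (rule mult_right_le_imp_le) (use fin ne in \<open>simp add: card_gt_0_iff\<close>)
  \<comment> \<open>Pigeonhole over the classes met by \<open>X\<close>: one of them contains at
    least \<open>exp (- 2 * k) * |A|\<close> elements of \<open>X\<close>, hence of
    \<open>A\<close>.\<close>
  define \<C> where "\<C> = (\<lambda>z. {x. \<alpha> x = z}) ` (\<alpha> ` X)"
  have "finite \<C>" "X \<subseteq> \<Union>\<C>" using finX by (auto simp: \<C>_def)
  moreover have "real (card \<C>) \<le> real (card (\<alpha> ` X))"
    unfolding \<C>_def using finX by (intro of_nat_mono card_image_le) auto
  ultimately obtain Y where Y: "Y \<in> \<C>" "real (card X) \<le> real (card (\<alpha> ` X)) * real (card (X \<inter> Y))"
    using cover_popular[OF _ finX X(2)] by metis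
  then obtain x where x: "x \<in> X" "Y = {x'. \<alpha> x' = \<alpha> x}" by (auto simp: \<C>_def)
  define f where "f = real (card {a \<in> A. \<alpha> a = \<alpha> x})"
  have "card (X \<inter> Y) \<le> card {a \<in> A. \<alpha> a = \<alpha> x}"
    using X x fin by (intro card_mono) auto
  then have "real (card X) \<le> real (card (\<alpha> ` X)) * f"
    using Y(2) by (smt (verit) f_def mult_left_mono of_nat_0_le_iff of_nat_le_iff)
  also have "\<dots> \<le> (exp (2 * k) / real (card A) * real (card X)) * f"
    using N by (intro mult_right_mono) (auto simp: f_def)
  finally have "1 * real (card X) \<le> (exp (2 * k) * (f / real (card A))) * real (card X)"
    by (simp add: ac_simps)
  then have "1 \<le> exp (2 * k) * (f / real (card A))"
    using X finX by (subst (asm) mult_le_cancel_right_pos) (auto simp: card_gt_0_iff)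
  then have "exp (- 2 * k) \<le> f / real (card A)"
    using mult_left_mono[of 1 "exp (2 * k) * (f / real (card A))" "exp (- 2 * k)"]
    by (simp flip: exp_add add: mult.assoc[symmetric])
  then show ?thesis using X x by (auto simp: fibre_weight_def \<alpha>_def f_def)
qed

section \<open>The iteration, and the choice of its exponent\<close>

section \<open>The weak Freiman--Ruzsa theorem over the integers\<close>

text \<open>The finite spanning set \<open>U\<close> witnesses the dimension. The bound
  \<open>d\<close> is on the logarithmic scale because the rank will be read off from
  \<open>2 ^ e\<close>; \<open>r\<close> bounds the inverse density.\<close>

definition low_dim_subset :: "(nat \<Rightarrow> int) set \<Rightarrow> real \<Rightarrow> real \<Rightarrow> bool" where
  "low_dim_subset A d r \<longleftrightarrow>
    (\<exists>A' U. A' \<subseteq> A \<and> A' \<noteq> {} \<and> finite U \<and> real (card U) * ln 2 \<le> d \<and>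
      (\<forall>a\<in>A'. \<forall>b\<in>A'. (\<lambda>i. real_of_int ((a - b) i)) \<in> fun_vs.span U) \<and>
      real (card A) / real (card A') \<le> r)"

text \<open>Induction on \<open>|A| + |B|\<close> with \<open>k\<close> and \<open>R\<close> fixed.
  The popular classes of \<open>A\<close> and \<open>B\<close> have density
  \<open>exp (- 2 * k)\<close> each, so \<open>h = 4 * k\<close>, and \<open>324\<close> is
  \<open>81 * 4\<close>. A proper pair of fibres loses in density only what is gained in
  \<open>T powr R\<close>; if nothing shrinks, the kernel bound limits the rank.\<close>

lemma exists_low_dim_subset:
  assumes adm: "admissible_PFR C\<^sub>P c"
  obtains C0 :: real where "C0 \<ge> 4"
    "\<And>(A :: (nat \<Rightarrow> int) set) B d k R. \<lbrakk>finite A; finite B; A \<noteq> {}; B \<noteq> {};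
       A \<subseteq> coord_space d; B \<subseteq> coord_space d; k \<ge> 0;
       real (card (A + B)) \<le> exp k * sqrt (real (card A) * real (card B));
       R \<ge> C0; R \<ge> C0 * (4 * k) powr (1 - 1 / C\<^sub>P)\<rbrakk> \<Longrightarrow>
       low_dim_subset A (324 * k)
         ((real (card (A + B)) / sqrt (real (card A) * real (card B))) powr R)"
proof -
  obtain C0 :: real where C0: "C0 \<ge> 4" and fibres:
    "\<And>(A :: (nat \<Rightarrow> int) set) B \<alpha> \<beta> \<gamma> n m0 m0' h R. \<lbrakk>finite A; finite B; A \<noteq> {}; B \<noteq> {};
       \<alpha> ` A \<subseteq> coord_space n; \<beta> ` B \<subseteq> coord_space n;
       \<forall>a\<in>A. \<forall>b\<in>B. \<gamma> (a + b) = \<alpha> a + \<beta> b;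
       m0 \<in> coord_space n; m0' \<in> coord_space n;
       exp (- h) \<le> fibre_weight A \<alpha> m0 * fibre_weight B \<beta> m0';
       R \<ge> C0; R \<ge> C0 * h powr (1 - 1 / C\<^sub>P)\<rbrakk> \<Longrightarrow>
       fibre_split A B \<alpha> \<beta> n (exp (81 * h)) R"
    using exists_economical_fibres[OF adm, where 'a = "nat \<Rightarrow> int"] by blast
  show thesis
  proof (rule that[OF C0])
    fix A B :: "(nat \<Rightarrow> int) set" and d and k R :: real
    assume "finite A" "finite B" "A \<noteq> {}" "B \<noteq> {}" "A \<subseteq> coord_space d" "B \<subseteq> coord_space d"
      and k: "k \<ge> 0" and small: "real (card (A + B)) \<le> exp k * sqrt (real (card A) * real (card B))"
      and R: "R \<ge> C0" "R \<ge> C0 * (4 * k) powr (1 - 1 / C\<^sub>P)"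
    then show "low_dim_subset A (324 * k)
         ((real (card (A + B)) / sqrt (real (card A) * real (card B))) powr R)"
    proof (induction "card A + card B" arbitrary: A B rule: less_induct)
      case less
      note fin = less.prems(1,2) and ne = less.prems(3,4) and small = less.prems(8)
      have pos: "card A > 0" "card B > 0" using fin ne by (auto simp: card_gt_0_iff)
      define T where "T = real (card (A + B)) / sqrt (real (card A) * real (card B))"
      have T1: "T \<ge> 1"
      proof -
        have "real (card A) * real (card B) \<le> real (card (A + B)) * real (card (A + B))"
          using card_le_sumset[OF fin] card_le_sumset'[OF fin] ne by (intro mult_mono) auto
        then have "sqrt (real (card A) * real (card B)) \<le> real (card (A + B))"
          by (intro real_le_lsqrt) (auto simp: power2_eq_square)
        then show ?thesis using pos by (simp add: T_def)
      qed
      have Tk: "T \<le> exp k" using small pos by (simp add: T_def divide_le_eq)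
      obtain a0 b0 where ab0: "a0 \<in> A" "b0 \<in> B" using ne by auto
      \<comment> \<open>Formed afresh for the current pair, so that it is generated by the
        differences within \<open>A\<close> and within \<open>B\<close>; otherwise the final case
        would not control its rank.\<close>
      define \<Lambda> where "\<Lambda> = group_closure ((\<lambda>a. a - a0) ` A \<union> (\<lambda>b. b - b0) ` B)"
      have \<Lambda>: "0 \<in> \<Lambda>" "\<And>x y. x \<in> \<Lambda> \<Longrightarrow> y \<in> \<Lambda> \<Longrightarrow> x - y \<in> \<Lambda>" "\<And>x y. x \<in> \<Lambda> \<Longrightarrow> y \<in> \<Lambda> \<Longrightarrow> x + y \<in> \<Lambda>"
        by (auto simp: \<Lambda>_def group_closure.diff group_closure_add)
      have A\<Lambda>: "a - a0 \<in> \<Lambda>" if "a \<in> A" for a using that by (auto simp: \<Lambda>_def intro: group_closure.base)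
      have B\<Lambda>: "b - b0 \<in> \<Lambda>" if "b \<in> B" for b using that by (auto simp: \<Lambda>_def intro: group_closure.base)
      have gens: "(\<lambda>a. a - a0) ` A \<union> (\<lambda>b. b - b0) ` B \<subseteq> coord_space d"
        using less.prems(5,6) ab0 by (intro Un_least image_subsetI coord_space_diff) (rule subsetD; assumption)+
      have "x \<in> coord_space d" if "x \<in> \<Lambda>" for x
        using that unfolding \<Lambda>_def
      proof (induction rule: group_closure.induct)
        case (base s)
        then show ?case using gens coord_space_0 by blast
      qed (rule coord_space_diff)
      then have "\<Lambda> \<subseteq> coord_space d" by blast
      then obtain e g U where g0: "\<forall>x\<in>\<Lambda>. \<forall>y\<in>\<Lambda>. g (x + y) = g x + g y"
        and im: "g ` \<Lambda> = (coord_space e :: (nat \<Rightarrow> bit) set)" and U: "finite U" "card U \<le> e"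
        and span: "\<forall>x\<in>\<Lambda>. (\<lambda>i. real_of_int (x i)) \<in> fun_vs.span U"
        using lattice_mod_2[OF _ \<Lambda>(1,2)] by blast
      have g: "g (x + y) = g x + g y" if "x \<in> \<Lambda>" "y \<in> \<Lambda>" for x y using g0 that by blast
      obtain a where a: "a \<in> A" "exp (- 2 * k) \<le> fibre_weight A (\<lambda>a. g (a - a0)) (g (a - a0))"
        using popular_fibre_mod_2[OF fin ne small \<Lambda>(2,3) g A\<Lambda> B\<Lambda>] by blast
      have "real (card (B + A)) \<le> exp k * sqrt (real (card B) * real (card A))"
        using small by (simp add: add.commute mult.commute)
      then obtain b where b: "b \<in> B" "exp (- 2 * k) \<le> fibre_weight B (\<lambda>b. g (b - b0)) (g (b - b0))"
        using popular_fibre_mod_2[OF fin(2,1) ne(2,1) _ \<Lambda>(2,3) g B\<Lambda> A\<Lambda>] by blast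
      have "exp (- 2 * k) * exp (- 2 * k) \<le> fibre_weight A (\<lambda>a. g (a - a0)) (g (a - a0)) *
          fibre_weight B (\<lambda>b. g (b - b0)) (g (b - b0))"
        using a b by (intro mult_mono) auto
      then have h: "exp (- (4 * k)) \<le> fibre_weight A (\<lambda>a. g (a - a0)) (g (a - a0)) *
          fibre_weight B (\<lambda>b. g (b - b0)) (g (b - b0))" by (simp flip: exp_add)
      have gAB: "\<forall>a\<in>A. \<forall>b\<in>B. g ((a + b) - (a0 + b0)) = g (a - a0) + g (b - b0)"
      proof (intro ballI)
        fix a b assume "a \<in> A" "b \<in> B"
        moreover have "(a + b) - (a0 + b0) = (a - a0) + (b - b0)" by (simp add: algebra_simps)
        ultimately show "g ((a + b) - (a0 + b0)) = g (a - a0) + g (b - b0)"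
          using g[OF A\<Lambda> B\<Lambda>] by (simp only:)
      qed
      have imA: "(\<lambda>a. g (a - a0)) ` A \<subseteq> coord_space e" and imB: "(\<lambda>b. g (b - b0)) ` B \<subseteq> coord_space e"
        unfolding im[symmetric] using A\<Lambda> B\<Lambda> by (intro image_subsetI imageI; blast)+
      have "g (a - a0) \<in> coord_space e" "g (b - b0) \<in> coord_space e"
        unfolding im[symmetric] using A\<Lambda> B\<Lambda> a b by (intro imageI; blast)+
      from fibres[where \<gamma> = "\<lambda>d. g (d - (a0 + b0))", OF fin ne imA imB gAB this h R]
      obtain \<pi> :: "(nat \<Rightarrow> bit) \<Rightarrow> nat \<Rightarrow> bit" and x y where
        \<pi>: "\<forall>x y. \<pi> (x + y) = \<pi> x + \<pi> y" and
        ker: "real (card {x \<in> coord_space e. \<pi> x = 0}) \<le> exp (81 * (4 * k))" and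
        xy: "let A' = {a \<in> A. \<pi> (g (a - a0)) = x}; B' = {b \<in> B. \<pi> (g (b - b0)) = y} in
           A' \<noteq> {} \<and> B' \<noteq> {} \<and> real (card (A' + B')) \<le> real (card (A + B)) *
             ((real (card A') / real (card A)) * (real (card B') / real (card B))) powr (1 / 2 + 1 / R)"
        unfolding fibre_split_def by (elim exE conjE) (rule that)
      define A1 B1 where "A1 = {a \<in> A. \<pi> (g (a - a0)) = x}" and "B1 = {b \<in> B. \<pi> (g (b - b0)) = y}"
      have ne1: "A1 \<noteq> {}" "B1 \<noteq> {}" and sum1: "real (card (A1 + B1)) \<le> real (card (A + B)) *
             ((real (card A1) / real (card A)) * (real (card B1) / real (card B))) powr (1 / 2 + 1 / R)"
        using xy unfolding A1_def[symmetric] B1_def[symmetric] Let_def by auto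
      have sub1: "A1 \<subseteq> A" "B1 \<subseteq> B" by (auto simp: A1_def B1_def)
      have fin1: "finite A1" "finite B1" using sub1 fin finite_subset by auto
      show ?case
      proof (cases "A1 = A \<and> B1 = B")
        \<comment> \<open>No shrinking means that \<open>\<pi>\<close> composed with
          \<open>g\<close> is constant, hence zero, on the generators and so on
          \<open>\<Lambda>\<close>. As \<open>g\<close> maps onto \<open>coord_space e\<close>, the
          kernel is the whole space, of size \<open>2 ^ e\<close>.\<close>
        case True
        have g00: "g 0 = 0" using g[of 0 0] \<Lambda>(1) by simp
        have \<pi>0: "\<pi> 0 = 0" using \<pi> by (metis add_cancel_right_right)
        have "a0 \<in> A1" "b0 \<in> B1" using True ab0 by simp_all
        then have "\<pi> (g (a0 - a0)) = x" "\<pi> (g (b0 - b0)) = y"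
          by (simp_all only: A1_def B1_def mem_Collect_eq)
        then have "x = 0" "y = 0" by (simp_all only: diff_self g00 \<pi>0)
        then have gen: "\<pi> (g (a - a0)) = 0" "\<pi> (g (b - b0)) = 0" if "a \<in> A" "b \<in> B" for a b
          using True that by (auto simp: A1_def B1_def)
        have zero: "\<pi> (g v) = 0" if "v \<in> \<Lambda>" for v
          using that unfolding \<Lambda>_def
        proof (induction rule: group_closure.induct)
          case (base s)
          then consider "s = 0" | a where "a \<in> A" "s = a - a0" | b where "b \<in> B" "s = b - b0" by blast
          then show ?case
          proof cases
            case 1
            then show ?thesis by (simp only: g00 \<pi>0)
          next
            case 2
            then show ?thesis using gen(1)[OF 2(1) ab0(2)] by (simp only:)
          next
            case 3
            then show ?thesis using gen(2)[OF ab0(1) 3(1)] by (simp only:)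
          qed
        next
          case (diff s t)
          have st: "s - t \<in> \<Lambda>" "t \<in> \<Lambda>"
            unfolding \<Lambda>_def using diff.hyps by (auto intro: group_closure.diff)
          have "\<pi> (g (s - t + t)) = \<pi> (g (s - t)) + \<pi> (g t)" using g[OF st] \<pi> by simp
          then show ?case by (simp only: diff_add_cancel diff.IH add_0_right)
        qed
        have "{x \<in> coord_space e. \<pi> x = 0} = coord_space e" using zero unfolding im[symmetric] by auto
        then have "(2::real) ^ e \<le> exp (324 * k)" using ker by (simp add: card_coord_space_bit)
        then have "ln ((2::real) ^ e) \<le> ln (exp (324 * k))" by (subst ln_le_cancel_iff) auto
        then have "real e * ln 2 \<le> 324 * k" by (simp add: ln_realpow)
        moreover have "real (card U) * ln 2 \<le> real e * ln 2" using U by (intro mult_right_mono) auto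
        ultimately have Uk: "real (card U) * ln 2 \<le> 324 * k" by linarith
        have "(\<lambda>i. real_of_int ((a - b) i)) \<in> fun_vs.span U" if "a \<in> A" "b \<in> A" for a b
        proof -
          have "(a - a0) - (b - a0) \<in> \<Lambda>" using that A\<Lambda> \<Lambda> by blast
          then show ?thesis using span by force
        qed
        moreover have "real (card A) / real (card A) \<le> T powr R"
          using pos T1 R C0 by (simp add: ge_one_powr_ge_zero)
        ultimately show ?thesis using U Uk ne unfolding T_def low_dim_subset_def by blast
      next
        case False
        have c1: "card A1 > 0" "card B1 > 0" using fin1 ne1 by (auto simp: card_gt_0_iff)
        have le1: "card A1 \<le> card A" "card B1 \<le> card B" using sub1 fin by (auto intro: card_mono)
        have "card A1 + card B1 < card A + card B"
        proof (cases "A1 = A")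
          case True
          then have "B1 \<subset> B" using False sub1 by auto
          then show ?thesis using le1 fin psubset_card_mono[of B B1] by simp
        next
          case False
          then have "A1 \<subset> A" using sub1 by auto
          then show ?thesis using le1 fin psubset_card_mono[of A A1] by simp
        qed
        note IH = less.hyps[OF this fin1 ne1]
        define u where "u = real (card A1) / real (card A)"
        define w where "w = real (card B1) / real (card B)"
        have u: "0 < u" "u \<le> 1" and w: "0 < w" "w \<le> 1" using c1 pos le1 by (auto simp: u_def w_def)
        have uw: "0 < u * w" "u * w \<le> 1" using u w by (auto simp: mult_le_one)
        define T1 where "T1 = real (card (A1 + B1)) / sqrt (real (card A1) * real (card B1))"
        have R0: "R > 0" using R C0 by linarith
        have sq: "sqrt (real (card A1) * real (card B1)) = sqrt (real (card A) * real (card B)) * (u * w) powr (1 / 2)"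
          using pos uw by (simp add: powr_half_sqrt u_def w_def flip: real_sqrt_mult)
        have T1T: "T1 \<le> T * (u * w) powr (1 / R)"
        proof -
          have "T1 \<le> real (card (A + B)) * (u * w) powr (1 / 2 + 1 / R) / sqrt (real (card A1) * real (card B1))"
            unfolding T1_def using sum1 by (intro divide_right_mono) (auto simp: u_def w_def)
          also have "\<dots> = T * (u * w) powr (1 / R)"
            unfolding sq powr_add using uw pos by (simp add: T_def)
          finally show ?thesis .
        qed
        have T10: "T1 \<ge> 0" by (simp add: T1_def)
        have "(u * w) powr (1 / R) \<le> 1" using uw R0 by (intro powr_le1) auto
        then have "T * (u * w) powr (1 / R) \<le> T * 1" using \<open>T \<ge> 1\<close> by (intro mult_left_mono) auto
        then have "T1 \<le> exp k" using T1T Tk by linarith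
        then have "real (card (A1 + B1)) \<le> exp k * sqrt (real (card A1) * real (card B1))"
          using c1 by (simp add: T1_def divide_le_eq)
        then have "low_dim_subset A1 (324 * k) (T1 powr R)"
          unfolding T1_def by (rule IH[OF order.trans[OF sub1(1) less.prems(5)]
            order.trans[OF sub1(2) less.prems(6)] less.prems(7) _ less.prems(9,10)])
        then obtain A' U' where A': "A' \<subseteq> A1" "A' \<noteq> {}" "finite U'" "real (card U') * ln 2 \<le> 324 * k"
          "\<forall>a\<in>A'. \<forall>b\<in>A'. (\<lambda>i. real_of_int ((a - b) i)) \<in> fun_vs.span U'"
          "real (card A1) / real (card A') \<le> T1 powr R"
          unfolding low_dim_subset_def by (elim exE conjE) (rule that)
        have "T1 powr R \<le> (T * (u * w) powr (1 / R)) powr R"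
          using T1T T10 R0 by (intro powr_mono2) auto
        also have "\<dots> = T powr R * (u * w)" using R0 u w \<open>T \<ge> 1\<close> by (simp add: powr_mult powr_powr)
        \<comment> \<open>The density of the fibre in \<open>B\<close> is discarded; dividing by
          \<open>u\<close> converts density in \<open>A1\<close> to density in
          \<open>A\<close>.\<close>
        also have "\<dots> \<le> T powr R * u" using u w by (intro mult_left_mono) (auto simp: mult_left_le)
        finally have "real (card A1) / real (card A') \<le> T powr R * u" using A'(6) by linarith
        then have "(real (card A1) / real (card A')) / u \<le> T powr R"
          using u by (simp only: pos_divide_le_eq)
        moreover have "(real (card A1) / real (card A')) / u = real (card A) / real (card A')"
          using c1 by (simp add: u_def)
        ultimately have "real (card A) / real (card A') \<le> T powr R" by simp
        then show ?thesis unfolding T_def low_dim_subset_def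
          by (intro exI[of _ A'] exI[of _ U'] conjI order.trans[OF A'(1) sub1(1)] A'(2-5))
      qed
    qed
  qed
qed

theorem theorem1p11:
  "\<exists>C'::real. \<forall>(C\<^sub>P::real) (c::real). admissible_PFR C\<^sub>P c \<longrightarrow>
     (\<exists>C::real. \<forall>(D::nat) (K::real) (A :: (nat \<Rightarrow> int) set).
        A \<subseteq> coord_space D \<and> finite A \<and> A \<noteq> {} \<and> doubling A \<le> K \<longrightarrow>
        (\<exists>A'. A' \<subseteq> A \<and>
              real (card A') / real (card A) \<ge> exp (- C * ln K powr (2 - 1 / C\<^sub>P)) \<and>
              real (affine_dim A') \<le> C' * ln K))"
proof (rule exI[of _ "324 / ln 2"], intro allI impI)
  fix C\<^sub>P c :: real assume adm: "admissible_PFR C\<^sub>P c"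
  define a where "a = 1 - 1 / C\<^sub>P"
  have a: "0 \<le> a" "a \<le> 1" using admissible_exponent_ge_1[OF adm] by (auto simp: a_def)
  obtain C0 :: real where C0: "C0 \<ge> 4" and low_dim:
    "\<And>(A :: (nat \<Rightarrow> int) set) B d k R. \<lbrakk>finite A; finite B; A \<noteq> {}; B \<noteq> {};
       A \<subseteq> coord_space d; B \<subseteq> coord_space d; k \<ge> 0;
       real (card (A + B)) \<le> exp k * sqrt (real (card A) * real (card B));
       R \<ge> C0; R \<ge> C0 * (4 * k) powr (1 - 1 / C\<^sub>P)\<rbrakk> \<Longrightarrow>
       low_dim_subset A (324 * k)
         ((real (card (A + B)) / sqrt (real (card A) * real (card B))) powr R)"
    using exists_low_dim_subset[OF adm] by blast
  text \<open>If \<open>ln K < k\<^sub>1\<close> then \<open>A\<close> is a singleton, so the constant factor lost when the exponent \<open>R\<close>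
    is bounded below by \<open>C0\<close> is harmless.\<close>
  define k1 where "k1 = min (ln 2 / (2 * C0)) (ln 2 / 648)"
  have ln2: "0 < ln (2::real)" "ln (2::real) < 1" using ln_2_less_1 by auto
  have k1: "0 < k1" "k1 \<le> 1 / 4" "k1 * C0 < ln 2" "324 * k1 < ln 2"
  proof -
    have "k1 \<le> ln 2 / (2 * C0)" "k1 \<le> ln 2 / 648" by (auto simp: k1_def)
    moreover from this have "k1 * C0 \<le> ln 2 / 2" using C0 by (simp add: field_simps)
    ultimately show "k1 \<le> 1 / 4" "324 * k1 < ln 2" "k1 * C0 < ln 2" using ln2 by linarith+
    show "0 < k1" using ln2 C0 by (simp add: k1_def)
  qed
  show "\<exists>C::real. \<forall>(D::nat) (K::real) (A :: (nat \<Rightarrow> int) set).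
        A \<subseteq> coord_space D \<and> finite A \<and> A \<noteq> {} \<and> doubling A \<le> K \<longrightarrow>
        (\<exists>A'. A' \<subseteq> A \<and>
              real (card A') / real (card A) \<ge> exp (- C * ln K powr (2 - 1 / C\<^sub>P)) \<and>
              real (affine_dim A') \<le> 324 / ln 2 * ln K)"
  proof (rule exI[of _ "4 * C0 / k1"], intro allI impI, elim conjE)
    fix D and K :: real and A :: "(nat \<Rightarrow> int) set"
    assume A: "A \<subseteq> coord_space D" "finite A" "A \<noteq> {}" "doubling A \<le> K"
    have cA: "card A > 0" using A by (simp add: card_gt_0_iff)
    have "card A \<le> card (A + A)" using card_le_sumset[OF A(2,2)] A(3) by auto
    then have "doubling A \<ge> 1" using cA by (simp add: doubling_def)
    then have K: "K \<ge> 1" using A by linarith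
    define k where "k = ln K"
    have k: "k \<ge> 0" "exp k = K" using K by (auto simp: k_def)
    \<comment> \<open>The least exponent allowed by both lower bounds.\<close>
    define R where "R = max C0 (C0 * (4 * k) powr a)"
    have "real (card (A + A)) \<le> exp k * sqrt (real (card A) * real (card A))"
      using A(4) cA by (simp add: doubling_def k(2) divide_le_eq)
    then obtain A' U where A': "A' \<subseteq> A" "A' \<noteq> {}" "finite U" "real (card U) * ln 2 \<le> 324 * k"
         "\<forall>a\<in>A'. \<forall>b\<in>A'. (\<lambda>i. real_of_int ((a - b) i)) \<in> fun_vs.span U"
         "real (card A) / real (card A') \<le>
           (real (card (A + A)) / sqrt (real (card A) * real (card A))) powr R"
      using low_dim[OF A(2,2,3,3,1,1) k(1), of R] unfolding low_dim_subset_def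
      by (auto simp: R_def a_def)
    have cA': "card A' > 0" using A' A finite_subset by (metis card_gt_0_iff)
    have dim: "affine_dim A' \<le> card U" using A' by (intro affine_dim_le_card) auto
    have R0: "R > 0" using C0 by (simp add: R_def)
    have "real (card A) / real (card A') \<le> (exp k) powr R"
    proof -
      have "doubling A powr R \<le> (exp k) powr R"
        using A(4) R0 k by (intro powr_mono2) (auto simp: doubling_def)
      then show ?thesis using A'(6) by (simp add: doubling_def)
    qed
    then have ratio: "real (card A) / real (card A') \<le> exp (k * R)" by (simp add: exp_powr_real)
    show "\<exists>A'. A' \<subseteq> A \<and>
              real (card A') / real (card A) \<ge> exp (- (4 * C0 / k1) * ln K powr (2 - 1 / C\<^sub>P)) \<and>
              real (affine_dim A') \<le> 324 / ln 2 * ln K"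
    proof (intro exI[of _ A'] conjI)
      show "A' \<subseteq> A" by fact
      \<comment> \<open>The number \<open>324\<close> does not involve \<open>C\<^sub>P\<close> or
        \<open>c\<close>, so the constant in the dimension bound is absolute.\<close>
      have "real (affine_dim A') * ln 2 \<le> real (card U) * ln 2" using dim ln2 by (intro mult_right_mono) auto
      then have "real (affine_dim A') * ln 2 \<le> 324 * ln K" using A'(4) unfolding k_def by linarith
      then show "real (affine_dim A') \<le> 324 / ln 2 * ln K"
        by (simp add: pos_le_divide_eq[OF ln2(1)])
      show "exp (- (4 * C0 / k1) * ln K powr (2 - 1 / C\<^sub>P)) \<le> real (card A') / real (card A)"
      proof (cases "k < k1")
        case True
        then have "(4 * k) powr a \<le> 1" using k1 k a by (intro powr_le1) auto
        then have "R = C0" using C0 by (simp add: R_def max_def mult_left_le)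
        moreover have "k * C0 \<le> k1 * C0" using True C0 by (intro mult_right_mono) auto
        ultimately have "k * R < ln 2" using k1 by simp
        then have "exp (k * R) < exp (ln 2)" by (subst exp_less_cancel_iff)
        then have lt2: "real (card A) / real (card A') < 2" using ratio by simp
        \<comment> \<open>Here \<open>324 * k < ln 2\<close> leaves no room for a spanning vector,
          so \<open>A'\<close> is a single point; as the inverse density is below \<open>2\<close>,
          so is \<open>A\<close>.\<close>
        have "real (card U) * ln 2 < 1 * ln 2" using A'(4) True k1 by linarith
        then have "real (card U) < 1" using ln2 by (subst (asm) mult_less_cancel_right_pos) auto
        then have "U = {}" using A'(3) by simp
        then have "a = b" if "a \<in> A'" "b \<in> A'" for a b
          using A'(5) that by (auto simp: fun_eq_iff)
        then have "card A' = 1" using A'(2) by (metis card_1_singleton_iff is_singletonI' is_singleton_def One_nat_def)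
        then have "card A = 1" using lt2 cA by simp
        then show ?thesis using \<open>card A' = 1\<close> C0 k1 by simp
      next
        case False
        then have kk: "k \<ge> k1" "k > 0" using k1 by auto
        \<comment> \<open>Uses \<open>k1 \<le> 1\<close> and \<open>0 \<le> a \<le> 1\<close>. It
          absorbs the constant lower bound \<open>C0\<close> for \<open>R\<close> into a multiple of
          \<open>k powr a\<close>, so that \<open>k * R\<close> is of order
          \<open>k powr (1 + a)\<close>.\<close>
        have ka: "k1 \<le> k powr a"
        proof -
          have "k1 = k1 powr 1" using k1 by simp
          also have "\<dots> \<le> k1 powr a" using k1 a by (intro powr_mono') auto
          also have "\<dots> \<le> k powr a" using k1 kk a by (intro powr_mono2) auto
          finally show ?thesis .
        qed
        have "R \<le> (4 * C0 / k1) * k powr a"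
        proof -
          have "C0 * k1 \<le> C0 * (4 * k powr a)" using ka C0 k1 by (intro mult_left_mono) auto
          then have "C0 \<le> (4 * C0 / k1) * k powr a" using k1 by (simp add: field_simps)
          moreover have "C0 * (4 * k) powr a \<le> (4 * C0 / k1) * k powr a"
          proof -
            have "(4::real) powr a \<le> 4 powr 1" using a by (intro powr_mono) auto
            then have "(4 * k) powr a \<le> 4 * k powr a" using kk by (simp add: powr_mult mult_right_mono)
            also have "\<dots> \<le> (4 / k1) * k powr a" using k1 by (intro mult_right_mono) (auto simp: field_simps)
            finally have "C0 * (4 * k) powr a \<le> C0 * ((4 / k1) * k powr a)" using C0 by (intro mult_left_mono) auto
            then show ?thesis by (simp add: ac_simps)
          qed
          ultimately show ?thesis by (simp add: R_def)
        qed
        then have "k * R \<le> k * ((4 * C0 / k1) * k powr a)" using kk by (intro mult_left_mono) auto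
        also have "\<dots> = (4 * C0 / k1) * k powr (1 + a)" using kk by (simp add: powr_add)
        finally have "k * R \<le> (4 * C0 / k1) * k powr (2 - 1 / C\<^sub>P)" by (simp add: a_def)
        then have "exp (- (4 * C0 / k1) * ln K powr (2 - 1 / C\<^sub>P)) \<le> exp (- (k * R))" by (simp add: k_def)
        also have "\<dots> \<le> real (card A') / real (card A)"
          using ratio cA cA' by (simp add: exp_minus field_simps)
        finally show ?thesis .
      qed
    qed
  qed
qed

end
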